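(* Let $r_+,r_-\ge0$ with $r_++r_->0$, let $n\in\mathbb{Z}$, and let $\mathsf{A}=(\mathbb{C}^\times)^{r_++r_-}$ with coordinates identified with $\vec a=(a_1,\dots,a_{r_+},b_1,\dots,b_{r_-})$. Let $$C_n(\vec a,\tau;y)=\frac{1}{2\pi i}\oint_{|s|\approx1}s^n\prod_{i=1}^{r_+}\frac{\vartheta(ysa_i;\tau)}{\vartheta(sa_i;\tau)}\prod_{j=1}^{r_-}\frac{\vartheta(y^{-1}sb_j;\tau)}{\vartheta(sb_j;\tau)}\,\frac{ds}{s}.$$ Then $$C_n(\vec a,\tau;y)=\chi\Big(\mathbb{P}(V),\ \mathcal{O}(n)\otimes\frac{\Theta(y\,\mathcal{O}(1)\otimes V_++y^{-1}\mathcal{O}(1)\otimes V_-)}{\Phi(\mathcal{O}(1)\otimes V)\,\Phi(\mathcal{O}(-1)\otimes V^\vee)}\Big)\in K_{\mathsf{A}}(\mathrm{pt})[y^{\pm1}][[q]]$$ is an $\mathsf{A}$-equivariant Euler characteristic, where $V=V_+\oplus V_-=\mathbb{C}^{r_+}\oplus\mathbb{C}^{r_-}$ and $\mathsf{A}\subset\mathrm{GL}(V)$ acts as the maximal torus.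
   Context: $q=e^{2\pi i\tau}$, $\phi(z)=\prod_{n>0}(1-q^nz)$, $\vartheta(z;\tau)=\vartheta(z)=(1-z^{-1})\phi(z)\phi(z^{-1})$. For a vector bundle $\mathcal{E}$ with Chern roots $\mathcal{L}$, $\Phi(\mathcal{E})=\prod_{\mathcal{L}}\phi(\mathcal{L})$ and $\Theta(\mathcal{E})=\prod_{\mathcal{L}}\vartheta(\mathcal{L})$, extended multiplicatively to K-theory. $\mathbb{P}(V)=(V\setminus0)/\mathbb{C}^\times$ is the space of lines in $V$ with its natural $\mathsf{A}$-equivariant $\mathcal{O}(1)$. The $a_i,b_j$ are viewed as fixed generic elements of $\mathbb{C}^\times$ with $|a_i|,|b_j|\gg1$. The contour $|s|\approx1$ encloses (counterclockwise) exactly the poles $s=a_i^{-1}$ and $s=b_j^{-1}$ of the integrand: it excludes $s=0,\infty$ and the $q$-shifted poles, i.e. those of the form $q^msa_i=1$ or $q^msb_j=1$ with $m\neq0$. *)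

theory Defs
  imports
    "HOL-Complex_Analysis.Complex_Analysis"
    "HOL-Computational_Algebra.Formal_Power_Series"
    "HOL-Library.Poly_Mapping"
    "HOL-Library.Function_Algebras"
    "HOL-Library.Multiset"
begin

section \<open>Theta functions\<close>

text \<open>
  Stated over a topological ring so that the same product is used analytically
  (complex \<open>q\<close>, \<open>z\<close>) and formally (\<open>q = fps_X\<close>, \<open>z\<close> a constant power series).
\<close>

definition phi :: "'a::{t2_space,comm_ring_1} \<Rightarrow> 'a \<Rightarrow> 'a" where
  "phi q z = prodinf (\<lambda>n. 1 - q ^ Suc n * z)"

definition nome :: "complex \<Rightarrow> complex" where
  "nome \<tau> = exp (2 * of_real pi * \<i> * \<tau>)"

definition theta :: "complex \<Rightarrow> complex \<Rightarrow> complex" where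
  "theta z \<tau> = (1 - inverse z) * phi (nome \<tau>) z * phi (nome \<tau>) (inverse z)"


section \<open>The contour integral\<close>

definition equiv_params :: "nat \<Rightarrow> (nat \<Rightarrow> complex) \<Rightarrow> (nat \<Rightarrow> complex) \<Rightarrow> nat \<Rightarrow> complex" where
  "equiv_params rp a b i = (if i < rp then a i else b (i - rp))"

definition C_integrand ::
  "nat \<Rightarrow> nat \<Rightarrow> int \<Rightarrow> (nat \<Rightarrow> complex) \<Rightarrow> (nat \<Rightarrow> complex) \<Rightarrow> complex \<Rightarrow> complex \<Rightarrow> complex \<Rightarrow> complex"
where
  "C_integrand rp rm n a b \<tau> y s =
     s powi n
     * (\<Prod>i<rp. theta (y * s * a i) \<tau> / theta (s * a i) \<tau>)
     * (\<Prod>j<rm. theta (inverse y * s * b j) \<tau> / theta (s * b j) \<tau>)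
     / s"

text \<open>
  For \<open>c\<close> the list of all the equivariant parameters, the points \<open>s\<close> with \<open>q\<^sup>m s c\<^sub>i = 1\<close>.
  The circle \<open>|s| = 1\<close> itself would also surround \<open>0\<close> and the shifted poles accumulating
  there; the contour is therefore specified by its winding numbers.
\<close>

definition shifted_pole :: "complex \<Rightarrow> (nat \<Rightarrow> complex) \<Rightarrow> int \<Rightarrow> nat \<Rightarrow> complex" where
  "shifted_pole q c m i = inverse (q powi m * c i)"

definition encloses_unshifted_poles ::
  "nat \<Rightarrow> (nat \<Rightarrow> complex) \<Rightarrow> complex \<Rightarrow> (real \<Rightarrow> complex) \<Rightarrow> bool"
where
  "encloses_unshifted_poles r c q \<gamma> \<longleftrightarrow>
     valid_path \<gamma> \<and> pathfinish \<gamma> = pathstart \<gamma> \<and>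
     0 \<notin> path_image \<gamma> \<and> winding_number \<gamma> 0 = 0 \<and>
     (\<forall>i<r. \<forall>m. shifted_pole q c m i \<notin> path_image \<gamma> \<and>
        winding_number \<gamma> (shifted_pole q c m i) = (if m = 0 then 1 else 0))"

definition C_integral ::
  "nat \<Rightarrow> nat \<Rightarrow> int \<Rightarrow> (real \<Rightarrow> complex) \<Rightarrow> (nat \<Rightarrow> complex) \<Rightarrow> (nat \<Rightarrow> complex) \<Rightarrow> complex \<Rightarrow> complex \<Rightarrow> complex"
where
  "C_integral rp rm n \<gamma> a b \<tau> y =
     1 / (2 * of_real pi * \<i>) * contour_integral \<gamma> (C_integrand rp rm n a b \<tau> y)"


section \<open>Equivariant cohomology of line bundles on projective space\<close>

text \<open>
  Throughout, \<open>V = \<complex>\<^sup>r\<close> with coordinates \<open>x\<^sub>i\<close>, \<open>i < r\<close>, and the torus \<open>A = (\<complex>\<^sup>\<times>)\<^sup>r\<close> acts on \<open>V\<close> by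
  \<open>t \<cdot> v = (t\<^sub>i v\<^sub>i)\<^sub>i\<close>. A finitely supported integer vector \<open>w\<close> supported in \<open>{..<r}\<close> stands for
  the character \<open>t \<mapsto> \<Prod>\<^sub>i t\<^sub>i\<^bsup>w\<^sub>i\<^esup>\<close> of \<open>A\<close>, and also for the Laurent monomial \<open>x\<^sup>w\<close>.
\<close>

type_synonym wt = "nat \<Rightarrow>\<^sub>0 int"

definition wts :: "nat \<Rightarrow> wt set" where
  "wts r = {w. Poly_Mapping.keys w \<subseteq> {..<r}}"

definition torus :: "nat \<Rightarrow> (nat \<Rightarrow> complex) set" where
  "torus r = {t. \<forall>i<r. t i \<noteq> 0}"

definition wt_eval :: "nat \<Rightarrow> wt \<Rightarrow> (nat \<Rightarrow> complex) \<Rightarrow> complex" where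
  "wt_eval r w t = (\<Prod>i<r. t i powi Poly_Mapping.lookup w i)"

type_synonym laurent = "wt \<Rightarrow>\<^sub>0 complex"

text \<open>
  \<open>\<P>(V)\<close> is the space of lines, so \<open>\<O>(k)\<close> has as its sections over the open set where all
  \<open>x\<^sub>i\<close>, \<open>i \<in> I\<close>, are nonzero the regular functions on the cone over that set which are
  homogeneous of degree \<open>k\<close>, i.e. the degree \<open>k\<close> part of \<open>\<complex>[x\<^sub>0, \<dots>, x\<^sub>r\<^sub>-\<^sub>1][x\<^sub>i\<inverse> : i \<in> I]\<close>.
\<close>

definition O_sections :: "nat \<Rightarrow> int \<Rightarrow> nat set \<Rightarrow> laurent set" where
  "O_sections r k I = {f. \<forall>m\<in>Poly_Mapping.keys f.
     m \<in> wts r \<and> (\<forall>i. i \<notin> I \<longrightarrow> 0 \<le> Poly_Mapping.lookup m i) \<and>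
     (\<Sum>i<r. Poly_Mapping.lookup m i) = k}"

text \<open>The action \<open>(t \<cdot> f)(v) = f(t\<inverse> v)\<close> on sections.\<close>

definition torus_act :: "nat \<Rightarrow> (nat \<Rightarrow> complex) \<Rightarrow> laurent \<Rightarrow> laurent" where
  "torus_act r t f = Poly_Mapping.mapp (\<lambda>m c. inverse (wt_eval r m t) * c) f"

definition scale_laurent :: "complex \<Rightarrow> laurent \<Rightarrow> laurent" where
  "scale_laurent c f = Poly_Mapping.map ((*) c) f"

text \<open>
  The alternating Cech complex of \<open>\<O>(k)\<close> for the standard affine cover
  \<open>{x\<^sub>i \<noteq> 0}\<close>, \<open>i < r\<close>: a \<open>p\<close>-cochain has a component for each \<open>I \<subseteq> {..<r}\<close> with \<open>p + 1\<close> elements.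
\<close>

type_synonym cochain = "nat set \<Rightarrow> laurent"

definition scale_cochain :: "complex \<Rightarrow> cochain \<Rightarrow> cochain" where
  "scale_cochain c \<sigma> = (\<lambda>I. scale_laurent c (\<sigma> I))"

definition cochains :: "nat \<Rightarrow> int \<Rightarrow> nat \<Rightarrow> cochain set" where
  "cochains r k p = {\<sigma>. \<forall>I.
     if I \<subseteq> {..<r} \<and> card I = Suc p then \<sigma> I \<in> O_sections r k I else \<sigma> I = 0}"

definition cobd :: "nat \<Rightarrow> cochain \<Rightarrow> cochain" where
  "cobd r \<sigma> J = (if J \<subseteq> {..<r}
     then \<Sum>j\<in>J. scale_laurent ((-1) ^ card {i\<in>J. i < j}) (\<sigma> (J - {j})) else 0)"

definition cocycles :: "nat \<Rightarrow> int \<Rightarrow> nat \<Rightarrow> cochain set" where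
  "cocycles r k p = {\<sigma> \<in> cochains r k p. cobd r \<sigma> = (\<lambda>J. 0)}"

definition coboundaries :: "nat \<Rightarrow> int \<Rightarrow> nat \<Rightarrow> cochain set" where
  "coboundaries r k p = (case p of 0 \<Rightarrow> {\<lambda>J. 0} | Suc p' \<Rightarrow> cobd r ` cochains r k p')"

definition weight_space :: "nat \<Rightarrow> wt \<Rightarrow> cochain set" where
  "weight_space r w = {\<sigma>. \<forall>t\<in>torus r. \<forall>I. torus_act r t (\<sigma> I) = scale_laurent (wt_eval r w t) (\<sigma> I)}"

text \<open>
  Multiplicity of the character \<open>w\<close> in \<open>H\<^sup>p(\<P>(V), \<O>(k))\<close>. Taking weight spaces is exact, and the
  weight spaces of the complex are finite-dimensional although the complex is not.
\<close>

definition H_mult :: "nat \<Rightarrow> int \<Rightarrow> nat \<Rightarrow> wt \<Rightarrow> int" where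
  "H_mult r k p w = (if w \<in> wts r
     then int (vector_space.dim scale_cochain (cocycles r k p \<inter> weight_space r w))
        - int (vector_space.dim scale_cochain (coboundaries r k p \<inter> weight_space r w))
     else 0)"

text \<open>
  \<open>K\<^sub>A(pt)\<close> is the group ring of the character lattice; for rank \<open>r\<close> only characters in
  \<^term>\<open>wts r\<close> occur. The cover has \<open>r\<close> members, so there is no cohomology in degrees \<open>\<ge> r\<close>.
\<close>

type_synonym KA = "wt \<Rightarrow>\<^sub>0 int"

definition H_char :: "nat \<Rightarrow> int \<Rightarrow> nat \<Rightarrow> KA" where
  "H_char r k p = Poly_Mapping.Abs_poly_mapping (H_mult r k p)"

definition chi_O :: "nat \<Rightarrow> int \<Rightarrow> KA" where
  "chi_O r k = (\<Sum>p<r. (-1) ^ p * H_char r k p)"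


section \<open>Classes on projective space and their Euler characteristics\<close>

text \<open>
  \<open>(k, l, w)\<close> stands for the line bundle \<open>y\<^sup>l \<O>(k) \<otimes> w\<close> on \<open>\<P>(V)\<close>, with \<open>w\<close> a character of \<open>A\<close>; tensor
  product is addition. \<open>K\<^sub>A(\<P>(V))[y\<^sup>\<plusminus>]\<close> is generated additively by these line bundles, and
  \<open>Kproj\<close> consists of the formal integer combinations representing its elements;
  multiplication is the tensor product.
\<close>

type_synonym line = "int \<times> int \<times> wt"
type_synonym Kproj = "line \<Rightarrow>\<^sub>0 int"
type_synonym KAy = "int \<Rightarrow>\<^sub>0 KA"

definition O_line :: "int \<Rightarrow> line" where "O_line k = (k, 0, 0)"

definition y_line :: "int \<Rightarrow> line" where "y_line l = (0, l, 0)"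

definition coord_line :: "nat \<Rightarrow> line" where
  "coord_line i = (0, 0, Poly_Mapping.single i 1)"

text \<open>A split vector bundle is given by the multiset of its Chern roots.\<close>

type_synonym vbundle = "line multiset"

definition V_plus :: "nat \<Rightarrow> vbundle" where
  "V_plus rp = image_mset coord_line (mset [0..<rp])"

definition V_minus :: "nat \<Rightarrow> nat \<Rightarrow> vbundle" where
  "V_minus rp rm = image_mset coord_line (mset [rp..<rp + rm])"

definition twist :: "line \<Rightarrow> vbundle \<Rightarrow> vbundle" where
  "twist L E = image_mset ((+) L) E"

definition dual_bundle :: "vbundle \<Rightarrow> vbundle" where
  "dual_bundle E = image_mset uminus E"

definition cls :: "line \<Rightarrow> Kproj fps" where
  "cls L = fps_const (Poly_Mapping.single L 1)"

definition Phi :: "vbundle \<Rightarrow> Kproj fps" where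
  "Phi E = (\<Prod>L\<in>#E. phi fps_X (cls L))"

definition Theta :: "vbundle \<Rightarrow> Kproj fps" where
  "Theta E = (\<Prod>L\<in>#E. (1 - cls (- L)) * phi fps_X (cls L) * phi fps_X (cls (- L)))"

text \<open>The inverse below is the one of a power series with constant term \<open>1\<close>.\<close>

definition C_class :: "nat \<Rightarrow> nat \<Rightarrow> int \<Rightarrow> Kproj fps" where
  "C_class rp rm n = (let Vp = V_plus rp; Vm = V_minus rp rm; V = Vp + Vm in
     cls (O_line n)
     * Theta (twist (y_line 1 + O_line 1) Vp + twist (y_line (-1) + O_line 1) Vm)
     * fps_right_inverse (Phi (twist (O_line 1) V) * Phi (twist (O_line (-1)) (dual_bundle V))) 1)"

text \<open>Additivity, and \<open>\<chi>(w \<otimes> \<O>(k)) = w \<chi>(\<O>(k))\<close> for a character \<open>w\<close>.\<close>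

definition chi_P :: "nat \<Rightarrow> Kproj \<Rightarrow> KAy" where
  "chi_P r F = (\<Sum>(k, l, w)\<in>Poly_Mapping.keys F.
     Poly_Mapping.single l (Poly_Mapping.single w (Poly_Mapping.lookup F (k, l, w)) * chi_O r k))"

definition chi_P_fps :: "nat \<Rightarrow> Kproj fps \<Rightarrow> KAy fps" where
  "chi_P_fps r F = Abs_fps (\<lambda>d. chi_P r (fps_nth F d))"

definition KA_pt_y_q :: "nat \<Rightarrow> KAy fps set" where
  "KA_pt_y_q r = {X. \<forall>d l. Poly_Mapping.keys (Poly_Mapping.lookup (fps_nth X d) l) \<subseteq> wts r}"

definition KA_eval :: "nat \<Rightarrow> (nat \<Rightarrow> complex) \<Rightarrow> KA \<Rightarrow> complex" where
  "KA_eval r c f = (\<Sum>w\<in>Poly_Mapping.keys f. of_int (Poly_Mapping.lookup f w) * wt_eval r w c)"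

definition KAy_eval :: "nat \<Rightarrow> (nat \<Rightarrow> complex) \<Rightarrow> complex \<Rightarrow> KAy \<Rightarrow> complex" where
  "KAy_eval r c y g = (\<Sum>l\<in>Poly_Mapping.keys g. KA_eval r c (Poly_Mapping.lookup g l) * y powi l)"

end

theory Submission
  imports Defs
begin

text \<open>
  Both sides are sums over the coordinate lines of \<open>V\<close>. On the geometric side this is localization:
  in the Cech complex of \<open>\<O>(k)\<close> each weight space is contractible unless all exponents are nonnegative
  or all are negative, and the resulting character of \<open>\<chi>(\<O>(k))\<close> satisfies the same recursion as
  \<open>\<Sum>\<^sub>i c\<^sub>i\<^bsup>-k\<^esup> / \<Prod>\<^sub>j\<^sub>\<noteq>\<^sub>i (1 - c\<^sub>i / c\<^sub>j)\<close>. On the analytic side it is the residue theorem, the simple pole \<open>s = c\<^sub>i\<inverse>\<close>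
  contributing \<open>1 / \<Prod>\<^sub>j\<^sub>\<noteq>\<^sub>i (1 - c\<^sub>i / c\<^sub>j)\<close> times the value there of the remaining factors, which is the class
  restricted to the \<open>i\<close>-th line. That this value is the sum of the formal \<open>q\<close>-series follows because it
  is holomorphic in \<open>q\<close> on a disc on which no \<open>\<phi>(c\<^sub>j / c\<^sub>i)\<close> vanishes.
\<close>

section \<open>Cohomology of line bundles on projective space\<close>

text \<open>The shape of \<open>theta_q\<close> makes the two sides match. In the denominator, at u
  = s c_j, only the factor 1 - 1/u carries the unshifted pole s = 1/c_j. Once the pole at s = 1/c_i
  is split off, the other such factors become the denominators 1 - c_i/c_j of localization. The
  \<open>phi\<close> factors are regular there and are the restriction of the two \<open>Phi\<close>
  classes. This is why the class is divided by \<open>Phi\<close> and not by a full theta class: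
  localization supplies the missing elementary factors.

  Localization is applied to each coefficient of q, a finite combination of line bundles, and is
  proved numerically at distinct nonzero c_i, where no denominator vanishes. The q-series is then
  summed on each coordinate line separately. The condition |q| |c_j| < |c_k| enters twice: it puts q
  in a disc on which every phi(c_j/c_k) is nonzero, and it separates the poles 1/c_i from the
  shifted ones.

  Since \<open>phi\<close> is one definition read in two topologies, the formal product first has to
  be computed from \<open>prodinf\<close>, and its agreement with the analytic one is a statement of
  its own.\<close>

lemma lookup_scale_laurent [simp]:
  "Poly_Mapping.lookup (scale_laurent c f) m = c * Poly_Mapping.lookup f m"
  by (simp add: scale_laurent_def Poly_Mapping.map.rep_eq when_def)

lemma scale_laurent_0_right [simp]: "scale_laurent c 0 = 0"
  by (rule poly_mapping_eqI) simp

lemma lookup_torus_act: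
  "Poly_Mapping.lookup (torus_act r t f) m = inverse (wt_eval r m t) * Poly_Mapping.lookup f m"
  by (simp add: torus_act_def lookup_mapp when_def in_keys_iff)

interpretation cochain: vector_space scale_cochain
  by unfold_locales
    (auto intro!: ext poly_mapping_eqI simp: scale_cochain_def lookup_add algebra_simps)

section \<open>The Cech differential\<close>

definition cech_sign :: "nat \<Rightarrow> nat set \<Rightarrow> complex" where
  "cech_sign j J = (-1) ^ card {i\<in>J. i < j}"

lemma lookup_cobd:
  assumes "J \<subseteq> {..<r}"
  shows "Poly_Mapping.lookup (cobd r \<sigma> J) m =
    (\<Sum>j\<in>J. cech_sign j J * Poly_Mapping.lookup (\<sigma> (J - {j})) m)"
  using assms by (simp add: cobd_def lookup_sum cech_sign_def)

lemma cech_sign_insert: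
  assumes "finite J" "j \<notin> J"
  shows "cech_sign l (insert j J) = (if j < l then - cech_sign l J else cech_sign l J)"
proof (cases "j < l")
  case True
  then have "{i \<in> insert j J. i < l} = insert j {i\<in>J. i < l}" by auto
  with assms True show ?thesis by (simp add: cech_sign_def)
next
  case False
  then have "{i \<in> insert j J. i < l} = {i\<in>J. i < l}" by auto
  with False show ?thesis by (simp add: cech_sign_def)
qed

lemma cech_sign_remove:
  assumes "finite J" "j \<in> J"
  shows "cech_sign l (J - {j}) = (if j < l then - cech_sign l J else cech_sign l J)"
  using cech_sign_insert[of "J - {j}" j l] assms by (auto simp: insert_absorb)

lemma cech_sign_square [simp]: "cech_sign l J * cech_sign l J = 1"
  by (simp add: cech_sign_def flip: power_add mult_2)

text \<open>Removing l and then k leaves the same set as removing k and then l, but with the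
  opposite sign. Swapping the ordered pair therefore shows the double sum to be its own
  negative.\<close>

lemma cobd_cobd: "cobd r (cobd r \<sigma>) = (\<lambda>J. 0)"
proof (intro ext poly_mapping_eqI)
  fix J :: "nat set" and m :: wt
  show "Poly_Mapping.lookup (cobd r (cobd r \<sigma>) J) m = Poly_Mapping.lookup 0 m"
  proof (cases "J \<subseteq> {..<r}")
    case True
    then have fin: "finite J" using finite_subset by blast
    define h where "h l k = cech_sign l J * (cech_sign k (J - {l}) *
      Poly_Mapping.lookup (\<sigma> (J - {l} - {k})) m)" for l k
    define P where "P = Sigma J (\<lambda>l. J - {l})"
    have "Poly_Mapping.lookup (cobd r (cobd r \<sigma>) J) m = (\<Sum>l\<in>J. \<Sum>k\<in>J - {l}. h l k)"
      unfolding lookup_cobd[OF True]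
    proof (rule sum.cong[OF refl])
      fix l assume "l \<in> J"
      have "J - {l} \<subseteq> {..<r}" using True by auto
      then show "cech_sign l J * Poly_Mapping.lookup (cobd r \<sigma> (J - {l})) m = (\<Sum>k\<in>J - {l}. h l k)"
        by (simp add: lookup_cobd h_def sum_distrib_left)
    qed
    also have "\<dots> = (\<Sum>(l, k)\<in>P. h l k)"
      unfolding P_def using fin by (simp add: sum.Sigma)
    finally have eq: "Poly_Mapping.lookup (cobd r (cobd r \<sigma>) J) m = (\<Sum>(l, k)\<in>P. h l k)" .
    have "(\<Sum>(l, k)\<in>P. h l k) = (\<Sum>(l, k)\<in>P. h k l)"
      by (rule sum.reindex_bij_witness[of _ prod.swap prod.swap]) (auto simp: P_def)
    also have "\<dots> = (\<Sum>(l, k)\<in>P. - h l k)"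
    proof (rule sum.cong[OF refl])
      fix x assume "x \<in> P"
      then obtain l k where lk: "x = (l, k)" "l \<in> J" "k \<in> J" "k \<noteq> l" by (auto simp: P_def)
      have "J - {k} - {l} = J - {l} - {k}" by auto
      with lk fin show "(case x of (l, k) \<Rightarrow> h k l) = (case x of (l, k) \<Rightarrow> - h l k)"
        by (auto simp: h_def cech_sign_remove)
    qed
    also have "\<dots> = - (\<Sum>(l, k)\<in>P. h l k)"
      by (simp add: sum_negf case_prod_unfold)
    finally have "(\<Sum>(l, k)\<in>P. h l k) = 0" by simp
    with eq show ?thesis by simp
  qed (simp add: cobd_def)
qed

lemma O_sections_0 [simp]: "0 \<in> O_sections r k I"
  by (simp add: O_sections_def)

lemma O_sections_mono: "f \<in> O_sections r k I \<Longrightarrow> I \<subseteq> J \<Longrightarrow> f \<in> O_sections r k J"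
  by (auto simp: O_sections_def)

lemma O_sections_scale: "f \<in> O_sections r k I \<Longrightarrow> scale_laurent c f \<in> O_sections r k I"
  by (auto simp: O_sections_def in_keys_iff)

lemma O_sections_sum:
  assumes "\<And>x. x \<in> A \<Longrightarrow> f x \<in> O_sections r k I"
  shows "sum f A \<in> O_sections r k I"
  unfolding O_sections_def
proof (intro CollectI ballI)
  fix m assume "m \<in> Poly_Mapping.keys (sum f A)"
  then have "(\<Sum>x\<in>A. Poly_Mapping.lookup (f x) m) \<noteq> 0"
    by (simp add: in_keys_iff lookup_sum)
  then obtain x where "x \<in> A" "Poly_Mapping.lookup (f x) m \<noteq> 0"
    by (rule sum.not_neutral_contains_not_neutral)
  with assms show "m \<in> wts r \<and> (\<forall>i. i \<notin> I \<longrightarrow> 0 \<le> Poly_Mapping.lookup m i) \<and>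
      (\<Sum>i<r. Poly_Mapping.lookup m i) = k"
    by (auto simp: O_sections_def in_keys_iff)
qed

lemma cobd_cochains:
  assumes "\<sigma> \<in> cochains r k p"
  shows "cobd r \<sigma> \<in> cochains r k (Suc p)"
  unfolding cochains_def
proof (intro CollectI allI)
  fix J
  show "if J \<subseteq> {..<r} \<and> card J = Suc (Suc p) then cobd r \<sigma> J \<in> O_sections r k J else cobd r \<sigma> J = 0"
  proof (cases "J \<subseteq> {..<r}")
    case True
    then have fin: "finite J" using finite_subset by blast
    show ?thesis
    proof (cases "card J = Suc (Suc p)")
      case card: True
      have "\<sigma> (J - {j}) \<in> O_sections r k J" if "j \<in> J" for j
      proof -
        have "J - {j} \<subseteq> {..<r} \<and> card (J - {j}) = Suc p"
          using True fin card that by auto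
        then have "\<sigma> (J - {j}) \<in> O_sections r k (J - {j})"
          using assms by (simp add: cochains_def)
        then show ?thesis by (rule O_sections_mono) auto
      qed
      then show ?thesis
        using True card by (auto simp: cobd_def intro!: O_sections_sum O_sections_scale)
    next
      case card: False
      have "\<sigma> (J - {j}) = 0" if "j \<in> J" for j
      proof -
        have "card (J - {j}) \<noteq> Suc p"
          using fin card that by (metis card.remove)
        then show ?thesis using assms unfolding cochains_def by auto
      qed
      then show ?thesis using True card by (simp add: cobd_def)
    qed
  qed (auto simp: cobd_def)
qed

lemma zero_cochains [simp]: "(\<lambda>J. 0) \<in> cochains r k p"
  by (simp add: cochains_def)

lemma cobd_zero [simp]: "cobd r (\<lambda>J. 0) = (\<lambda>J. 0)"
  by (auto simp: cobd_def)

lemma coboundaries_subset: "coboundaries r k p \<subseteq> cocycles r k p"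
  by (cases p) (auto simp: coboundaries_def cocycles_def cobd_cobd cobd_cochains)

section \<open>Weight spaces of the Cech complex\<close>

lemma wts_lookup: "w \<in> wts r \<Longrightarrow> \<not> i < r \<Longrightarrow> Poly_Mapping.lookup w i = 0"
  by (auto simp: wts_def in_keys_iff subset_iff)

lemma keys_eq_empty_iff: "Poly_Mapping.keys f = {} \<longleftrightarrow> f = 0"
  by (auto intro!: poly_mapping_eqI simp: in_keys_iff)

lemma wt_eval_uminus: "wt_eval r (- w) t = inverse (wt_eval r w t)"
  by (simp add: wt_eval_def power_int_minus prod_inversef[symmetric] o_def)

text \<open>Functions transform by the inverse of the character of their monomial, so weight w
  belongs to the monomial with exponent - w; this sign persists throughout.\<close>

lemma weight_space_keys:
  assumes "\<sigma> \<in> weight_space r w" "w \<in> wts r" "m \<in> wts r" "m \<in> Poly_Mapping.keys (\<sigma> I)"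
  shows "m = - w"
proof (rule poly_mapping_eqI)
  fix i
  show "Poly_Mapping.lookup m i = Poly_Mapping.lookup (- w) i"
  proof (cases "i < r")
    case True
    \<comment> \<open>A torus element moving only coordinate i detects the i-th exponent. Since 2
      has absolute value above 1, equal powers of it have equal exponents.\<close>
    define t :: "nat \<Rightarrow> complex" where "t = (\<lambda>j. if j = i then 2 else 1)"
    have ev: "wt_eval r u t = 2 powi Poly_Mapping.lookup u i" for u
    proof -
      have "wt_eval r u t = (\<Prod>j<r. if j = i then 2 powi Poly_Mapping.lookup u i else 1)"
        unfolding wt_eval_def t_def by (rule prod.cong) auto
      then show ?thesis using True by simp
    qed
    have "t \<in> torus r" by (auto simp: t_def torus_def)
    then have "torus_act r t (\<sigma> I) = scale_laurent (wt_eval r w t) (\<sigma> I)"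
      using assms(1) by (simp add: weight_space_def)
    then have "inverse (wt_eval r m t) * Poly_Mapping.lookup (\<sigma> I) m =
        wt_eval r w t * Poly_Mapping.lookup (\<sigma> I) m"
      by (metis lookup_torus_act lookup_scale_laurent)
    then have "inverse (wt_eval r m t) = wt_eval r w t"
      using assms(4) by (simp add: in_keys_iff)
    then have "(2::complex) powi (- Poly_Mapping.lookup m i) = 2 powi Poly_Mapping.lookup w i"
      by (simp add: ev power_int_minus)
    then have "norm ((2::complex) powi (- Poly_Mapping.lookup m i)) = norm ((2::complex) powi Poly_Mapping.lookup w i)"
      by simp
    then have "(2::real) powi (- Poly_Mapping.lookup m i) = 2 powi Poly_Mapping.lookup w i"
      by (simp add: norm_power_int)
    then have "- Poly_Mapping.lookup m i = Poly_Mapping.lookup w i"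
      using power_int_strict_increasing[of "- Poly_Mapping.lookup m i" "Poly_Mapping.lookup w i" "2::real"]
        power_int_strict_increasing[of "Poly_Mapping.lookup w i" "- Poly_Mapping.lookup m i" "2::real"]
      by (cases "- Poly_Mapping.lookup m i" "Poly_Mapping.lookup w i" rule: linorder_cases) auto
    then show ?thesis by simp
  next
    case False
    then show ?thesis using assms(2,3) by (simp add: wts_lookup)
  qed
qed

lemma weight_spaceI:
  assumes "\<And>I. Poly_Mapping.keys (\<sigma> I) \<subseteq> {- w}"
  shows "\<sigma> \<in> weight_space r w"
  unfolding weight_space_def
proof (intro CollectI ballI allI poly_mapping_eqI)
  fix t I m
  show "Poly_Mapping.lookup (torus_act r t (\<sigma> I)) m
      = Poly_Mapping.lookup (scale_laurent (wt_eval r w t) (\<sigma> I)) m"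
    using assms[of I] by (cases "m = - w") (auto simp: lookup_torus_act wt_eval_uminus in_keys_iff)
qed

text \<open>This reduces the weight w part to combinatorics: a cochain is a choice of scalars, one
  for each I of the right size containing every index where w is positive, and nothing at all if the
  degree is wrong.\<close>

lemma weight_cochain_keys:
  assumes "\<sigma> \<in> cochains r k p" "\<sigma> \<in> weight_space r w" "w \<in> wts r" "m \<in> Poly_Mapping.keys (\<sigma> I)"
  shows "m = - w" "I \<subseteq> {..<r}" "card I = Suc p" "\<And>i. i \<notin> I \<Longrightarrow> Poly_Mapping.lookup w i \<le> 0"
    "(\<Sum>i<r. Poly_Mapping.lookup w i) = - k"
proof -
  show I: "I \<subseteq> {..<r}" "card I = Suc p"
    using assms(1,4) unfolding cochains_def by (metis (mono_tags, lifting) mem_Collect_eq keys_zero empty_iff)+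
  then have "\<sigma> I \<in> O_sections r k I"
    using assms(1) by (simp add: cochains_def)
  then have m: "m \<in> wts r" "\<And>i. i \<notin> I \<Longrightarrow> 0 \<le> Poly_Mapping.lookup m i" "(\<Sum>i<r. Poly_Mapping.lookup m i) = k"
    using assms(4) by (auto simp: O_sections_def)
  show eq: "m = - w" using weight_space_keys assms m by blast
  show "\<And>i. i \<notin> I \<Longrightarrow> Poly_Mapping.lookup w i \<le> 0" using m(2) eq by force
  show "(\<Sum>i<r. Poly_Mapping.lookup w i) = - k" using m(3) eq by (auto simp: sum_negf)
qed

text \<open>The contracting homotopy \<open>\<tau>\<^sub>I = \<plusminus> \<sigma>\<^bsub>I \<union> {j}\<^esub>\<close> stays inside the Cech complex because \<open>x\<^sub>j\<close> has a
  nonnegative exponent in the only monomial of weight \<open>w\<close>.\<close>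

lemma weight_cocycle_coboundary:
  assumes \<sigma>: "\<sigma> \<in> cocycles r k p" "\<sigma> \<in> weight_space r w" and w: "w \<in> wts r"
    and j: "j < r" "Poly_Mapping.lookup w j \<le> 0"
    and p: "p > 0 \<or> (\<exists>i<r. Poly_Mapping.lookup w i > 0)"
  shows "\<sigma> \<in> coboundaries r k p"
proof -
  have coch: "\<sigma> \<in> cochains r k p" and cyc: "cobd r \<sigma> J = 0" for J
    using \<sigma>(1) by (auto simp: cocycles_def)
  define \<tau> where "\<tau> I = (if I \<subseteq> {..<r} \<and> j \<notin> I then scale_laurent (cech_sign j I) (\<sigma> (insert j I)) else 0)" for I
  have \<sigma>0: "\<sigma> J = 0" if "\<not> (J \<subseteq> {..<r} \<and> card J = Suc p)" for J
    using coch that unfolding cochains_def by (metis (mono_tags, lifting) mem_Collect_eq)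
  have eq: "cobd r \<tau> = \<sigma>"
  proof (rule ext, rule poly_mapping_eqI)
    fix J m
    show "Poly_Mapping.lookup (cobd r \<tau> J) m = Poly_Mapping.lookup (\<sigma> J) m"
    proof (cases "J \<subseteq> {..<r}")
      case True
      then have fin: "finite J" using finite_subset by blast
      show ?thesis
      proof (cases "j \<in> J")
        case jJ: True
        \<comment> \<open>For l other than j the set J - {l} still contains j, and \<tau> vanishes
          on it. Only l = j is left, and its two equal signs multiply to 1.\<close>
        have "Poly_Mapping.lookup (cobd r \<tau> J) m =
            (\<Sum>l\<in>J. if l = j then Poly_Mapping.lookup (\<sigma> J) m else 0)"
          unfolding lookup_cobd[OF True]
        proof (rule sum.cong[OF refl])
          fix l assume "l \<in> J"
          then show "cech_sign l J * Poly_Mapping.lookup (\<tau> (J - {l})) m =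
              (if l = j then Poly_Mapping.lookup (\<sigma> J) m else 0)"
            using True jJ fin
            by (auto simp: \<tau>_def cech_sign_remove insert_absorb mult.assoc[symmetric])
        qed
        also have "\<dots> = Poly_Mapping.lookup (\<sigma> J) m" using jJ fin by simp
        finally show ?thesis .
      next
        case jJ: False
        let ?s = "\<lambda>l. Poly_Mapping.lookup (\<sigma> (insert j J - {l})) m"
        have sub: "insert j J \<subseteq> {..<r}" using True j by auto
        \<comment> \<open>The cocycle condition on J together with j expresses \<sigma> at J through
          exactly the terms that make up the differential of \<tau> at J.\<close>
        have "0 = Poly_Mapping.lookup (cobd r \<sigma> (insert j J)) m" by (simp add: cyc)
        also have "\<dots> = cech_sign j (insert j J) * ?s j + (\<Sum>l\<in>J. cech_sign l (insert j J) * ?s l)"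
          unfolding lookup_cobd[OF sub] using fin jJ by simp
        finally have rel: "cech_sign j J * Poly_Mapping.lookup (\<sigma> J) m =
            - (\<Sum>l\<in>J. cech_sign l (insert j J) * ?s l)"
          using fin jJ by (simp add: cech_sign_insert eq_neg_iff_add_eq_0)
        have "Poly_Mapping.lookup (cobd r \<tau> J) m =
            (\<Sum>l\<in>J. - (cech_sign j J * (cech_sign l (insert j J) * ?s l)))"
          unfolding lookup_cobd[OF True]
        proof (rule sum.cong[OF refl])
          fix l assume l: "l \<in> J"
          then have "insert j J - {l} = insert j (J - {l})" "l \<noteq> j" using jJ by auto
          with l show "cech_sign l J * Poly_Mapping.lookup (\<tau> (J - {l})) m =
              - (cech_sign j J * (cech_sign l (insert j J) * ?s l))"
            using True jJ fin by (auto simp: \<tau>_def cech_sign_remove cech_sign_insert)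
        qed
        also have "\<dots> = cech_sign j J * (cech_sign j J * Poly_Mapping.lookup (\<sigma> J) m)"
          by (simp add: rel sum_negf sum_distrib_left)
        also have "\<dots> = Poly_Mapping.lookup (\<sigma> J) m"
          by (simp add: mult.assoc[symmetric])
        finally show ?thesis .
      qed
    qed (simp add: cobd_def \<sigma>0)
  qed
  show ?thesis
  proof (cases p)
    case 0
    with p obtain i where i: "i < r" "Poly_Mapping.lookup w i > 0" by auto
    \<comment> \<open>In degree 0 the homotopy would land over the empty set, outside the complex,
      so \<sigma> itself must vanish. The component over {j} is zero because the exponent of x_i is
      negative and i differs from j.\<close>
    have "\<tau> I = 0" for I
    proof (cases "I \<subseteq> {..<r} \<and> j \<notin> I \<and> card (insert j I) = Suc 0")
      case True
      then have "I = {}" using finite_subset[of I "{..<r}"] by auto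
      moreover have "Poly_Mapping.keys (\<sigma> {j}) = {}"
        using weight_cochain_keys(4)[OF coch \<sigma>(2) w, of _ "{j}" i] i j by fastforce
      ultimately show ?thesis by (auto simp: \<tau>_def)
    next
      case False
      then show ?thesis using \<sigma>0[of "insert j I"] 0 by (auto simp: \<tau>_def)
    qed
    then have "\<tau> = (\<lambda>J. 0)" by auto
    with eq have "\<sigma> = (\<lambda>J. 0)" by simp
    then show ?thesis by (simp add: coboundaries_def 0)
  next
    case (Suc p')
    have "\<tau> \<in> cochains r k p'"
      unfolding cochains_def
    proof (intro CollectI allI)
      fix I
      consider "I \<subseteq> {..<r}" "j \<notin> I" "card I = Suc p'" | "I \<subseteq> {..<r}" "j \<notin> I" "card I \<noteq> Suc p'"
        | "\<not> (I \<subseteq> {..<r} \<and> j \<notin> I)" by auto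
      then show "if I \<subseteq> {..<r} \<and> card I = Suc p' then \<tau> I \<in> O_sections r k I else \<tau> I = 0"
      proof cases
        case 1
        then have "finite I" using finite_subset by blast
        then have "insert j I \<subseteq> {..<r} \<and> card (insert j I) = Suc p"
          using 1 j Suc by simp
        then have "\<sigma> (insert j I) \<in> O_sections r k (insert j I)"
          using coch by (simp add: cochains_def)
        moreover have "0 \<le> Poly_Mapping.lookup m j" if "m \<in> Poly_Mapping.keys (\<sigma> (insert j I))" for m
          using weight_cochain_keys(1)[OF coch \<sigma>(2) w that] j by simp
        ultimately have "\<sigma> (insert j I) \<in> O_sections r k I"
          by (fastforce simp: O_sections_def)
        then show ?thesis using 1 by (simp add: \<tau>_def O_sections_scale)
      next
        case 2
        then have "finite I" using finite_subset by blast
        then have "card (insert j I) \<noteq> Suc p" using 2 Suc by simp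
        then have "\<sigma> (insert j I) = 0" using \<sigma>0 by blast
        then show ?thesis using 2 by (simp add: \<tau>_def)
      next
        case 3
        then show ?thesis by (auto simp: \<tau>_def)
      qed
    qed
    with eq show ?thesis by (auto simp: coboundaries_def Suc)
  qed
qed

lemma zero_weight_space [simp]: "(\<lambda>J. 0) \<in> weight_space r w"
  by (rule weight_spaceI) simp

lemma zero_coboundaries [simp]: "(\<lambda>J. 0) \<in> coboundaries r k p"
  by (cases p) (auto simp: coboundaries_def intro!: image_eqI[of _ _ "\<lambda>J. 0"])

section \<open>Multiplicity of a single weight in cohomology\<close>

lemma dim_zero_cochain: "cochain.dim {\<lambda>J. 0} = 0"
  using cochain.dim_span_eq_card_independent[OF cochain.independent_empty]
  by (simp add: zero_fun_def)

lemma dim_line_cochain: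
  assumes "e \<noteq> (\<lambda>J. 0)"
  shows "cochain.dim (range (\<lambda>c. scale_cochain c e)) = 1"
proof -
  have "\<not> cochain.dependent {e}"
    using assms by (simp add: cochain.dependent_single zero_fun_def)
  from cochain.dim_span_eq_card_independent[OF this] show ?thesis
    by (simp add: cochain.span_singleton)
qed

lemma H_mult_eq_0:
  assumes "w \<in> wts r" "\<And>\<sigma>. \<sigma> \<in> cochains r k p \<Longrightarrow> \<sigma> \<in> weight_space r w \<Longrightarrow> \<sigma> = (\<lambda>J. 0)"
  shows "H_mult r k p w = 0"
proof -
  have "cocycles r k p \<inter> weight_space r w = {\<lambda>J. 0}"
    using assms(2) by (auto simp: cocycles_def)
  moreover have "coboundaries r k p \<inter> weight_space r w = {\<lambda>J. 0}"
    using calculation coboundaries_subset[of r k p] by auto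
  ultimately show ?thesis by (simp add: H_mult_def)
qed

lemma H_mult_eq_1:
  assumes "w \<in> wts r" "e \<noteq> (\<lambda>J. 0)"
    and "cocycles r k p \<inter> weight_space r w = range (\<lambda>c. scale_cochain c e)"
    and "coboundaries r k p \<inter> weight_space r w = {\<lambda>J. 0}"
  shows "H_mult r k p w = 1"
  using assms by (simp add: H_mult_def dim_zero_cochain dim_line_cochain)

lemma poly_mapping_keys_single:
  assumes "Poly_Mapping.keys f \<subseteq> {a}"
  shows "f = Poly_Mapping.single a (Poly_Mapping.lookup f a)"
  by (rule poly_mapping_eqI) (use assms in \<open>auto simp: lookup_single when_def in_keys_iff\<close>)

text \<open>Here the monomial with exponent - w is a polynomial, hence a global section, represented
  by the cochain \<open>e\<close> with the same component on every chart. The cocycle condition on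
  the pairs {0, i} forces all components of a cocycle to agree, and there are no nonzero
  coboundaries in degree 0.\<close>

lemma H_mult_nonpos:
  assumes r: "r > 0" and w: "w \<in> wts r" "(\<Sum>i<r. Poly_Mapping.lookup w i) = - k"
    and neg: "\<And>i. i < r \<Longrightarrow> Poly_Mapping.lookup w i \<le> 0"
  shows "H_mult r k 0 w = 1"
proof -
  define e :: cochain where "e I = (if \<exists>i<r. I = {i} then Poly_Mapping.single (- w) 1 else 0)" for I
  have neg': "Poly_Mapping.lookup w i \<le> 0" for i
    using neg[of i] w(1) by (cases "i < r") (auto simp: wts_lookup)
  have "-w \<in> wts r" using w by (auto simp: wts_def in_keys_iff)
  then have sec: "Poly_Mapping.single (- w) 1 \<in> O_sections r k I" for I
    using w(2) neg' by (auto simp: O_sections_def sum_negf)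
  have e_coch: "e \<in> cochains r k 0"
    unfolding cochains_def e_def using sec by (auto simp: card_1_singleton_iff)
  have "cobd r e J = 0" for J
  proof (cases "J \<subseteq> {..<r}")
    case True
    show ?thesis
    proof (cases "card J = 2")
      case c2: True
      then obtain a b where ab: "J = {a, b}" "a < b"
        by (metis card_2_iff insert_commute linorder_less_linear)
      have "{i \<in> J. i < a} = {}" "{i \<in> J. i < b} = {a}"
        using ab by auto
      then have "cech_sign a J = 1" "cech_sign b J = -1" by (simp_all only: cech_sign_def) simp_all
      moreover have "e (J - {a}) = Poly_Mapping.single (- w) 1" "e (J - {b}) = Poly_Mapping.single (- w) 1"
      proof -
        have "J - {a} = {b}" "J - {b} = {a}" "a < r" "b < r" using ab True by auto
        then show "e (J - {a}) = Poly_Mapping.single (- w) 1" "e (J - {b}) = Poly_Mapping.single (- w) 1"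
          by (auto simp: e_def)
      qed
      moreover have "sum f J = f a + f b" for f :: "nat \<Rightarrow> complex" using ab by simp
      ultimately show ?thesis
        by (intro poly_mapping_eqI) (simp add: lookup_cobd[OF True])
    next
      case False
      have "e (J - {j}) = 0" if j: "j \<in> J" for j
      proof -
        have "\<not> (\<exists>i<r. J - {j} = {i})"
        proof
          assume "\<exists>i<r. J - {j} = {i}"
          then obtain i where "J - {j} = {i}" by auto
          with j have "J = {i, j}" "i \<noteq> j" by auto
          with False show False by simp
        qed
        then show ?thesis unfolding e_def by (rule if_not_P)
      qed
      then show ?thesis by (simp add: cobd_def)
    qed
  qed (simp add: cobd_def)
  then have e_cyc: "e \<in> cocycles r k 0" using e_coch by (auto simp: cocycles_def)
  have keys_e: "Poly_Mapping.keys (e I) \<subseteq> {- w}" for I by (auto simp: e_def)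
  have "\<exists>c. \<sigma> = scale_cochain c e" if \<sigma>: "\<sigma> \<in> cocycles r k 0" "\<sigma> \<in> weight_space r w" for \<sigma>
  proof -
    have coch: "\<sigma> \<in> cochains r k 0" and cyc: "cobd r \<sigma> J = 0" for J
      using \<sigma>(1) by (auto simp: cocycles_def)
    let ?g = "\<lambda>i. Poly_Mapping.lookup (\<sigma> {i}) (- w)"
    have const: "?g i = ?g 0" if "i < r" for i
    proof (cases "i = 0")
      case False
      have sub: "{0, i} \<subseteq> {..<r}" using that r by auto
      have "{l. (l = 0 \<or> l = i) \<and> l < i} = {0}" using False by auto
      then have "cech_sign 0 {0, i} = 1" "cech_sign i {0, i} = -1"
        using False by (auto simp: cech_sign_def)
      moreover have "{0, i} - {0} = {i}" "{0, i} - {i} = {0}" using False by auto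
      moreover have "Poly_Mapping.lookup (cobd r \<sigma> {0, i}) (- w) = 0" by (simp add: cyc)
      ultimately show ?thesis using False by (simp add: lookup_cobd[OF sub])
    qed simp
    have "\<sigma> I = scale_laurent (?g 0) (e I)" for I
    proof (cases "\<exists>i<r. I = {i}")
      case True
      then obtain i where i: "i < r" "I = {i}" by auto
      have "Poly_Mapping.keys (\<sigma> I) \<subseteq> {- w}"
        using weight_cochain_keys(1)[OF coch \<sigma>(2) w(1)] by auto
      from poly_mapping_keys_single[OF this] show ?thesis
        using i const[OF i(1)] by (intro poly_mapping_eqI) (auto simp: e_def lookup_single when_def)
    next
      case False
      then have "\<not> (I \<subseteq> {..<r} \<and> card I = Suc 0)" by (auto simp: card_1_singleton_iff)
      then have "\<sigma> I = 0" using coch unfolding cochains_def by (metis (mono_tags, lifting) mem_Collect_eq)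
      then show ?thesis unfolding e_def if_not_P[OF False] by simp
    qed
    then show ?thesis by (auto simp: scale_cochain_def)
  qed
  moreover have "scale_cochain c e \<in> cocycles r k 0 \<inter> weight_space r w" for c
  proof -
    have "scale_cochain c e \<in> weight_space r w"
      by (rule weight_spaceI) (use keys_e in \<open>force simp: scale_cochain_def in_keys_iff\<close>)
    moreover have "scale_cochain c e \<in> cochains r k 0"
      using e_coch unfolding cochains_def scale_cochain_def by (auto simp: O_sections_scale)
    moreover have "cobd r (scale_cochain c e) J = 0" for J
    proof (cases "J \<subseteq> {..<r}")
      case True
      have "Poly_Mapping.lookup (cobd r (scale_cochain c e) J) m = c * Poly_Mapping.lookup (cobd r e J) m" for m
        unfolding lookup_cobd[OF True] by (simp add: scale_cochain_def sum_distrib_left ac_simps)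
      then show ?thesis using e_cyc by (intro poly_mapping_eqI) (simp add: cocycles_def)
    qed (simp add: cobd_def)
    ultimately show ?thesis by (auto simp: cocycles_def)
  qed
  ultimately have "cocycles r k 0 \<inter> weight_space r w = range (\<lambda>c. scale_cochain c e)" by auto
  moreover have "e {0} \<noteq> 0" using r by (auto simp: e_def simp flip: keys_eq_empty_iff)
  then have "e \<noteq> (\<lambda>J. 0)" by auto
  ultimately show ?thesis
    by (intro H_mult_eq_1 w) (auto simp: coboundaries_def)
qed

text \<open>All exponents of the monomial are negative, so it is regular only on the intersection of
  all charts. There every cochain is a cocycle, and a coboundary cannot contain it: a component over
  r - 1 charts has a nonnegative exponent at the missing index.\<close>

lemma H_mult_pos:
  assumes r: "Suc p = r" and w: "w \<in> wts r" "(\<Sum>i<r. Poly_Mapping.lookup w i) = - k"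
    and pos: "\<And>i. i < r \<Longrightarrow> Poly_Mapping.lookup w i > 0"
  shows "H_mult r k p w = 1"
proof -
  define e :: cochain where "e I = (if I = {..<r} then Poly_Mapping.single (- w) 1 else 0)" for I
  have "-w \<in> wts r" using w by (auto simp: wts_def in_keys_iff)
  moreover have "Poly_Mapping.lookup w i \<le> 0" if "i \<notin> {..<r}" for i
    using that w(1) by (simp add: wts_lookup)
  ultimately have sec: "Poly_Mapping.single (- w) 1 \<in> O_sections r k {..<r}"
    using w(2) by (auto simp: O_sections_def sum_negf)
  have top: "I = {..<r}" if "I \<subseteq> {..<r}" "card I = Suc p" for I
    using that r by (intro card_subset_eq) auto
  have coch: "scale_cochain c e \<in> cochains r k p" for c
    unfolding cochains_def scale_cochain_def e_def using sec top r by (auto intro: O_sections_scale)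
  have cyc: "cobd r \<sigma> = (\<lambda>J. 0)" if "\<sigma> \<in> cochains r k p" for \<sigma>
  proof
    fix J
    have "\<not> (J \<subseteq> {..<r} \<and> card J = Suc (Suc p))"
      using card_mono[of "{..<r}" J] r by auto
    then show "cobd r \<sigma> J = 0"
      using cobd_cochains[OF that] unfolding cochains_def by (metis (mono_tags, lifting) mem_Collect_eq)
  qed
  have line: "\<sigma> = scale_cochain (Poly_Mapping.lookup (\<sigma> {..<r}) (- w)) e"
    if \<sigma>: "\<sigma> \<in> cochains r k p" "\<sigma> \<in> weight_space r w" for \<sigma>
  proof
    fix I
    show "\<sigma> I = scale_cochain (Poly_Mapping.lookup (\<sigma> {..<r}) (- w)) e I"
    proof (cases "I = {..<r}")
      case True
      have "Poly_Mapping.keys (\<sigma> I) \<subseteq> {- w}"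
        using weight_cochain_keys(1)[OF \<sigma> w(1)] by auto
      from poly_mapping_keys_single[OF this] show ?thesis
        using True by (subst \<open>I = _\<close>) (simp add: e_def scale_cochain_def scale_laurent_def)
    next
      case False
      then have "\<not> (I \<subseteq> {..<r} \<and> card I = Suc p)" using top by auto
      then have "\<sigma> I = 0" using \<sigma>(1) unfolding cochains_def by (metis (mono_tags, lifting) mem_Collect_eq)
      then show ?thesis using False by (simp add: e_def scale_cochain_def)
    qed
  qed
  have "scale_cochain c e \<in> weight_space r w" for c
    by (rule weight_spaceI) (auto simp: scale_cochain_def e_def in_keys_iff lookup_single when_def split: if_splits)
  then have "scale_cochain c e \<in> cocycles r k p \<inter> weight_space r w" for c
    using coch cyc by (auto simp: cocycles_def)
  moreover have "\<sigma> \<in> range (\<lambda>c. scale_cochain c e)" if "\<sigma> \<in> cocycles r k p \<inter> weight_space r w" for \<sigma>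
    using line[of \<sigma>] that unfolding cocycles_def by blast
  ultimately have Z: "cocycles r k p \<inter> weight_space r w = range (\<lambda>c. scale_cochain c e)"
    by auto
  have "\<sigma> = (\<lambda>J. 0)" if \<sigma>: "\<sigma> \<in> coboundaries r k p" "\<sigma> \<in> weight_space r w" for \<sigma>
  proof (cases p)
    case 0
    then show ?thesis using \<sigma> by (simp add: coboundaries_def)
  next
    case (Suc p')
    then obtain \<tau> where \<tau>: "\<tau> \<in> cochains r k p'" "\<sigma> = cobd r \<tau>"
      using \<sigma> by (auto simp: coboundaries_def)
    have "Poly_Mapping.lookup (\<tau> ({..<r} - {l})) (- w) = 0" if l: "l < r" for l
    proof -
      have "{..<r} - {l} \<subseteq> {..<r} \<and> card ({..<r} - {l}) = Suc p'"
        using l Suc r by auto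
      then have "\<tau> ({..<r} - {l}) \<in> O_sections r k ({..<r} - {l})"
        using \<tau>(1) by (simp add: cochains_def)
      then have "- w \<notin> Poly_Mapping.keys (\<tau> ({..<r} - {l}))"
        using pos[OF l] unfolding O_sections_def by fastforce
      then show ?thesis by (simp add: in_keys_iff)
    qed
    then have "Poly_Mapping.lookup (\<sigma> {..<r}) (- w) = 0"
      using \<tau>(2) by (simp add: lookup_cobd)
    moreover have "\<sigma> \<in> cochains r k p"
      using \<sigma>(1) coboundaries_subset[of r k p] by (auto simp: cocycles_def)
    ultimately have "\<sigma> = scale_cochain 0 e" using line[of \<sigma>] \<sigma>(2) by simp
    then show ?thesis by (auto intro!: poly_mapping_eqI simp: scale_cochain_def)
  qed
  then have "coboundaries r k p \<inter> weight_space r w = {\<lambda>J. 0}" by auto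
  moreover have "e {..<r} \<noteq> 0" by (simp add: e_def flip: keys_eq_empty_iff)
  then have "e \<noteq> (\<lambda>J. 0)" by metis
  ultimately show ?thesis using Z by (intro H_mult_eq_1 w)
qed

lemma H_mult_eq:
  assumes p: "p < r"
  shows "H_mult r k p w =
    (if w \<in> wts r \<and> (\<Sum>i<r. Poly_Mapping.lookup w i) = - k then
       (if p = 0 \<and> (\<forall>i<r. Poly_Mapping.lookup w i \<le> 0) then 1 else 0) +
       (if Suc p = r \<and> (\<forall>i<r. Poly_Mapping.lookup w i > 0) then 1 else 0) else 0)"
proof -
  consider "w \<notin> wts r" | "w \<in> wts r" "(\<Sum>i<r. Poly_Mapping.lookup w i) \<noteq> - k"
    | (npos) "w \<in> wts r" "(\<Sum>i<r. Poly_Mapping.lookup w i) = - k" "p = 0" "\<forall>i<r. Poly_Mapping.lookup w i \<le> 0"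
    | (pos) "w \<in> wts r" "(\<Sum>i<r. Poly_Mapping.lookup w i) = - k" "\<forall>i<r. Poly_Mapping.lookup w i > 0"
    | (mixed) j where "w \<in> wts r" "(\<Sum>i<r. Poly_Mapping.lookup w i) = - k"
      "j < r" "Poly_Mapping.lookup w j \<le> 0" "p > 0 \<or> (\<exists>i<r. Poly_Mapping.lookup w i > 0)"
    by (metis linorder_not_less not_gr0)
  then show ?thesis
  proof cases
    case 1
    then show ?thesis by (simp add: H_mult_def)
  next
    case 2
    have "\<sigma> = (\<lambda>J. 0)" if "\<sigma> \<in> cochains r k p" "\<sigma> \<in> weight_space r w" for \<sigma>
    proof
      fix J
      have "Poly_Mapping.keys (\<sigma> J) = {}"
        using weight_cochain_keys(5)[OF that 2(1)] 2(2) by blast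
      then show "\<sigma> J = 0" by (simp add: keys_eq_empty_iff)
    qed
    then show ?thesis using 2 by (simp add: H_mult_eq_0)
  next
    case npos
    have "\<not> (\<forall>i<r. Poly_Mapping.lookup w i > 0)" using npos p by force
    then show ?thesis using npos p H_mult_nonpos[of r w k] by simp
  next
    case pos
    have n: "\<not> (\<forall>i<r. Poly_Mapping.lookup w i \<le> 0)" using pos p by force
    show ?thesis
    proof (cases "Suc p = r")
      case True
      then show ?thesis using pos n H_mult_pos[of p r w k] by simp
    next
      case False
      have "\<sigma> = (\<lambda>J. 0)" if "\<sigma> \<in> cochains r k p" "\<sigma> \<in> weight_space r w" for \<sigma>
      proof
        fix J
        have "Poly_Mapping.keys (\<sigma> J) = {}"
        proof (rule ccontr)
          assume "Poly_Mapping.keys (\<sigma> J) \<noteq> {}"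
          then obtain m where m: "m \<in> Poly_Mapping.keys (\<sigma> J)" by blast
          note W = weight_cochain_keys[OF that pos(1) m]
          have "J \<noteq> {..<r}" using W(3) False by auto
          then obtain i where "i < r" "i \<notin> J" using W(2) by auto
          then show False using W(4)[of i] pos(3) by force
        qed
        then show "\<sigma> J = 0" by (simp add: keys_eq_empty_iff)
      qed
      then show ?thesis using pos n False by (simp add: H_mult_eq_0)
    qed
  next
    case mixed
    \<comment> \<open>Cocycles and coboundaries of this weight coincide as sets, so the two
      dimensions cancel without being computed.\<close>
    have "cocycles r k p \<inter> weight_space r w = coboundaries r k p \<inter> weight_space r w"
      using weight_cocycle_coboundary[of _ r k p w j] mixed coboundaries_subset[of r k p] by auto
    then have "H_mult r k p w = 0" by (simp add: H_mult_def)
    moreover have "\<not> (p = 0 \<and> (\<forall>i<r. Poly_Mapping.lookup w i \<le> 0))"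
      using mixed by force
    moreover have "\<not> (\<forall>i<r. Poly_Mapping.lookup w i > 0)" using mixed by force
    ultimately show ?thesis by auto
  qed
qed

section \<open>Localization\<close>

text \<open>The characters of global sections; \<open>pos_wts\<close> lists those of top cohomology.
  An arbitrary index set S replaces {..<r} because the recursion below deletes arbitrary
  coordinates.\<close>

definition npos_wts :: "nat set \<Rightarrow> int \<Rightarrow> wt set" where
  "npos_wts S k = {w. Poly_Mapping.keys w \<subseteq> S \<and> (\<forall>i\<in>S. Poly_Mapping.lookup w i \<le> 0) \<and>
     (\<Sum>i\<in>S. Poly_Mapping.lookup w i) = - k}"

definition pos_wts :: "nat set \<Rightarrow> int \<Rightarrow> wt set" where
  "pos_wts S k = {w. Poly_Mapping.keys w \<subseteq> S \<and> (\<forall>i\<in>S. Poly_Mapping.lookup w i > 0) \<and>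
     (\<Sum>i\<in>S. Poly_Mapping.lookup w i) = - k}"

definition char_on :: "nat set \<Rightarrow> (nat \<Rightarrow> complex) \<Rightarrow> wt \<Rightarrow> complex" where
  "char_on S c w = (\<Prod>i\<in>S. c i powi Poly_Mapping.lookup w i)"

lemma keys_subset_iff: "Poly_Mapping.keys f \<subseteq> S \<longleftrightarrow> (\<forall>j. j \<notin> S \<longrightarrow> Poly_Mapping.lookup f j = 0)"
  by (auto simp: in_keys_iff)

lemma finite_bounded_wts:
  assumes "finite S"
  shows "finite {w::wt. Poly_Mapping.keys w \<subseteq> S \<and> (\<forall>i\<in>S. \<bar>Poly_Mapping.lookup w i\<bar> \<le> N)}"
proof (rule finite_imageD)
  have "finite {f. \<forall>i. (i \<in> S \<longrightarrow> f i \<in> {-N..N}) \<and> (i \<notin> S \<longrightarrow> f i = (0::int))}"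
    using assms by (intro finite_set_of_finite_funs) auto
  then show "finite (Poly_Mapping.lookup ` {w::wt. Poly_Mapping.keys w \<subseteq> S \<and>
      (\<forall>i\<in>S. \<bar>Poly_Mapping.lookup w i\<bar> \<le> N)})"
    by (rule finite_subset[rotated]) (auto simp: in_keys_iff abs_le_iff)
qed (auto simp: inj_on_def poly_mapping.lookup_inject)

text \<open>Entries of one sign cannot cancel, so each is bounded by the absolute value of the
  total.\<close>

lemma finite_npos_wts:
  assumes "finite S"
  shows "finite (npos_wts S k)"
proof (rule finite_subset[OF _ finite_bounded_wts[OF assms, of "\<bar>k\<bar>"]])
  show "npos_wts S k \<subseteq> {w. Poly_Mapping.keys w \<subseteq> S \<and> (\<forall>i\<in>S. \<bar>Poly_Mapping.lookup w i\<bar> \<le> \<bar>k\<bar>)}"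
  proof (rule subsetI, intro CollectI conjI ballI)
    fix w i
    assume "w \<in> npos_wts S k"
    then have w: "\<forall>i\<in>S. Poly_Mapping.lookup w i \<le> 0" "(\<Sum>i\<in>S. Poly_Mapping.lookup w i) = - k"
      and "Poly_Mapping.keys w \<subseteq> S"
      by (auto simp: npos_wts_def)
    then show "Poly_Mapping.keys w \<subseteq> S" by simp
    assume "i \<in> S"
    with w have "(\<Sum>i\<in>S. Poly_Mapping.lookup w i) \<le> Poly_Mapping.lookup w i"
      using assms sum_nonpos[of "S - {i}" "Poly_Mapping.lookup w"] by (simp add: sum.remove)
    with w \<open>i \<in> S\<close> show "\<bar>Poly_Mapping.lookup w i\<bar> \<le> \<bar>k\<bar>" by force
  qed
qed

lemma finite_pos_wts:
  assumes "finite S"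
  shows "finite (pos_wts S k)"
proof (rule finite_subset[OF _ finite_bounded_wts[OF assms, of "\<bar>k\<bar>"]])
  show "pos_wts S k \<subseteq> {w. Poly_Mapping.keys w \<subseteq> S \<and> (\<forall>i\<in>S. \<bar>Poly_Mapping.lookup w i\<bar> \<le> \<bar>k\<bar>)}"
  proof (rule subsetI, intro CollectI conjI ballI)
    fix w i
    assume "w \<in> pos_wts S k"
    then have w: "\<forall>i\<in>S. Poly_Mapping.lookup w i > 0" "(\<Sum>i\<in>S. Poly_Mapping.lookup w i) = - k"
      and "Poly_Mapping.keys w \<subseteq> S"
      by (auto simp: pos_wts_def)
    then show "Poly_Mapping.keys w \<subseteq> S" by simp
    assume "i \<in> S"
    with w have "(\<Sum>i\<in>S. Poly_Mapping.lookup w i) \<ge> Poly_Mapping.lookup w i"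
      using assms sum_nonneg[of "S - {i}" "Poly_Mapping.lookup w"] by (simp add: sum.remove less_imp_le)
    with w \<open>i \<in> S\<close> show "\<bar>Poly_Mapping.lookup w i\<bar> \<le> \<bar>k\<bar>" by force
  qed
qed

section \<open>Recursion by restriction to a coordinate hyperplane\<close>

lemma char_on_shift:
  assumes "finite S" "i \<in> S" "c i \<noteq> 0"
  shows "char_on S c (w - Poly_Mapping.single i 1) = char_on S c w / c i"
proof -
  have "(\<Prod>j\<in>S - {i}. c j powi Poly_Mapping.lookup (w - Poly_Mapping.single i 1) j)
      = (\<Prod>j\<in>S - {i}. c j powi Poly_Mapping.lookup w j)"
    by (rule prod.cong) (auto simp: lookup_minus lookup_single when_def)
  then show ?thesis
    using assms by (simp add: char_on_def prod.remove lookup_minus power_int_diff)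
qed

lemma char_on_remove:
  assumes "finite S" "i \<in> S" "Poly_Mapping.lookup w i = 0"
  shows "char_on S c w = char_on (S - {i}) c w"
  using assms by (simp add: char_on_def prod.remove)

lemma image_shift:
  "(\<lambda>w. w - Poly_Mapping.single i (1::int)) ` P = {w. w + Poly_Mapping.single i 1 \<in> P}"
  by (force simp: image_iff)

lemma lookup_shift:
  "Poly_Mapping.lookup (w + Poly_Mapping.single i (1::int)) j =
    Poly_Mapping.lookup w j + (if j = i then 1 else 0)"
  by (simp add: lookup_add lookup_single when_def)

lemma keys_shift:
  assumes "i \<in> S"
  shows "Poly_Mapping.keys (w + Poly_Mapping.single i (1::int)) \<subseteq> S \<longleftrightarrow> Poly_Mapping.keys w \<subseteq> S"
  unfolding keys_subset_iff using assms by (auto simp: lookup_shift)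

lemma sum_lookup_shift:
  assumes "finite S" "i \<in> S"
  shows "(\<Sum>j\<in>S. Poly_Mapping.lookup (w + Poly_Mapping.single i 1) j) = (\<Sum>j\<in>S. Poly_Mapping.lookup w j) + (1::int)"
  using assms by (simp add: lookup_shift sum.distrib)

lemma keys_subset_remove:
  "Poly_Mapping.keys w \<subseteq> S - {i} \<longleftrightarrow> Poly_Mapping.keys w \<subseteq> S \<and> Poly_Mapping.lookup w i = 0"
  by (auto simp: keys_subset_iff)

lemma sum_lookup_remove:
  assumes "finite S" "i \<in> S" "Poly_Mapping.lookup w i = (0::int)"
  shows "(\<Sum>j\<in>S - {i}. Poly_Mapping.lookup w j) = (\<Sum>j\<in>S. Poly_Mapping.lookup w j)"
  using assms by (simp add: sum.remove)

text \<open>On global sections this is multiplication by x_i from O(k - 1) to O(k): a monomial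
  either is divisible by x_i or comes from the hyperplane x_i = 0.\<close>

lemma npos_wts_split:
  assumes "finite S" "i \<in> S"
  shows "npos_wts S k = npos_wts (S - {i}) k \<union> (\<lambda>w. w - Poly_Mapping.single i 1) ` npos_wts S (k - 1)"
    and "npos_wts (S - {i}) k \<inter> (\<lambda>w. w - Poly_Mapping.single i 1) ` npos_wts S (k - 1) = {}"
proof -
  have 1: "w \<in> npos_wts (S - {i}) k \<longleftrightarrow> w \<in> npos_wts S k \<and> Poly_Mapping.lookup w i = 0" for w
  proof (cases "Poly_Mapping.lookup w i = 0")
    case True
    then have "(\<forall>j\<in>S - {i}. Poly_Mapping.lookup w j \<le> 0) \<longleftrightarrow> (\<forall>j\<in>S. Poly_Mapping.lookup w j \<le> 0)"
      using assms by (metis Diff_iff order.refl singletonD)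
    then show ?thesis
      using True unfolding npos_wts_def mem_Collect_eq keys_subset_remove sum_lookup_remove[OF assms True] by simp
  qed (simp add: npos_wts_def keys_subset_remove)
  have 2: "w \<in> (\<lambda>w. w - Poly_Mapping.single i 1) ` npos_wts S (k - 1) \<longleftrightarrow>
      w \<in> npos_wts S k \<and> Poly_Mapping.lookup w i < 0" for w
  proof -
    have "(\<forall>j\<in>S. Poly_Mapping.lookup (w + Poly_Mapping.single i 1) j \<le> 0) \<longleftrightarrow>
        (\<forall>j\<in>S. Poly_Mapping.lookup w j \<le> 0) \<and> Poly_Mapping.lookup w i < 0" (is "?L = ?R")
    proof
      assume ?L
      then have "Poly_Mapping.lookup w j + (if j = i then 1 else 0) \<le> 0" if "j \<in> S" for j
        using that by (simp add: lookup_shift)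
      from this[OF assms(2)] this show ?R by (force split: if_splits)
    next
      assume ?R
      then show ?L unfolding lookup_shift by auto
    qed
    then show ?thesis
      unfolding image_shift npos_wts_def mem_Collect_eq keys_shift[OF assms(2)] sum_lookup_shift[OF assms]
      by auto
  qed
  have "w \<in> npos_wts S k \<Longrightarrow> Poly_Mapping.lookup w i \<le> 0" for w
    using assms by (simp add: npos_wts_def)
  then show "npos_wts S k = npos_wts (S - {i}) k \<union> (\<lambda>w. w - Poly_Mapping.single i 1) ` npos_wts S (k - 1)"
    unfolding set_eq_iff Un_iff 1 2 by force
  show "npos_wts (S - {i}) k \<inter> (\<lambda>w. w - Poly_Mapping.single i 1) ` npos_wts S (k - 1) = {}"
    unfolding set_eq_iff Int_iff 1 2 by auto
qed

text \<open>The same multiplication by x_i on top cohomology. It is now surjective, and its kernel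
  is the top cohomology of the hyperplane, so the hyperplane appears on the other side of the
  equation.\<close>

lemma pos_wts_split:
  assumes "finite S" "i \<in> S"
  shows "(\<lambda>w. w - Poly_Mapping.single i 1) ` pos_wts S (k - 1) = pos_wts (S - {i}) k \<union> pos_wts S k"
    and "pos_wts (S - {i}) k \<inter> pos_wts S k = {}"
proof -
  let ?Q = "\<lambda>w. Poly_Mapping.keys w \<subseteq> S \<and> (\<forall>j\<in>S - {i}. Poly_Mapping.lookup w j > 0) \<and>
     (\<Sum>i\<in>S. Poly_Mapping.lookup w i) = - k"
  have 1: "w \<in> pos_wts (S - {i}) k \<longleftrightarrow> ?Q w \<and> Poly_Mapping.lookup w i = 0" for w
  proof (cases "Poly_Mapping.lookup w i = 0")
    case True
    then show ?thesis
      unfolding pos_wts_def mem_Collect_eq keys_subset_remove sum_lookup_remove[OF assms True] by simp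
  qed (simp add: pos_wts_def keys_subset_remove)
  have 2: "w \<in> (\<lambda>w. w - Poly_Mapping.single i 1) ` pos_wts S (k - 1) \<longleftrightarrow>
      ?Q w \<and> Poly_Mapping.lookup w i \<ge> 0" for w
  proof -
    have "(\<forall>j\<in>S. Poly_Mapping.lookup (w + Poly_Mapping.single i 1) j > 0) \<longleftrightarrow>
        (\<forall>j\<in>S - {i}. Poly_Mapping.lookup w j > 0) \<and> Poly_Mapping.lookup w i \<ge> 0" (is "?L = ?R")
    proof
      assume ?L
      then have "Poly_Mapping.lookup w j + (if j = i then 1 else 0) > 0" if "j \<in> S" for j
        using that by (simp add: lookup_shift)
      from this[OF assms(2)] this show ?R by (force split: if_splits)
    next
      assume ?R
      then show ?L unfolding lookup_shift by auto
    qed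
    then show ?thesis
      unfolding image_shift pos_wts_def mem_Collect_eq keys_shift[OF assms(2)] sum_lookup_shift[OF assms]
      by auto
  qed
  have "(\<forall>j\<in>S. Poly_Mapping.lookup w j > 0) \<longleftrightarrow>
      (\<forall>j\<in>S - {i}. Poly_Mapping.lookup w j > 0) \<and> Poly_Mapping.lookup w i > 0" for w :: wt
    using assms by fastforce
  then have 3: "w \<in> pos_wts S k \<longleftrightarrow> ?Q w \<and> Poly_Mapping.lookup w i > 0" for w
    unfolding pos_wts_def mem_Collect_eq by blast
  show "(\<lambda>w. w - Poly_Mapping.single i 1) ` pos_wts S (k - 1) = pos_wts (S - {i}) k \<union> pos_wts S k"
    unfolding set_eq_iff Un_iff 1 2 3 by (metis order.order_iff_strict)
  show "pos_wts (S - {i}) k \<inter> pos_wts S k = {}"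
    unfolding set_eq_iff Int_iff 1 3 by auto
qed

definition chi_sum :: "nat set \<Rightarrow> (nat \<Rightarrow> complex) \<Rightarrow> int \<Rightarrow> complex" where
  "chi_sum S c k = (\<Sum>w\<in>npos_wts S k. char_on S c w) +
     (-1) ^ (card S - 1) * (\<Sum>w\<in>pos_wts S k. char_on S c w)"

text \<open>The Atiyah-Bott sum: the tangent space at the i-th coordinate line has weights c_j/c_i,
  and each contributes 1 minus its inverse to the denominator.\<close>

definition fixed_point_sum :: "nat set \<Rightarrow> (nat \<Rightarrow> complex) \<Rightarrow> int \<Rightarrow> complex" where
  "fixed_point_sum S c k = (\<Sum>i\<in>S. c i powi (- k) / (\<Prod>j\<in>S - {i}. 1 - c i / c j))"

lemma sum_char_on_shift:
  assumes "finite S" "i \<in> S" "c i \<noteq> 0"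
  shows "(\<Sum>w\<in>(\<lambda>w. w - Poly_Mapping.single i 1) ` P. char_on S c w) = (\<Sum>w\<in>P. char_on S c w) / c i"
  using assms by (subst sum.reindex) (auto simp: inj_on_def char_on_shift sum_divide_distrib)

text \<open>Additivity of the Euler characteristic on the exact sequence of the hyperplane x_i = 0.
  The dimension drops by one, so the sign of top cohomology flips, which compensates for the
  opposite direction of the two splittings. Excluding S = {i} keeps the hyperplane nonempty and the
  subtraction in the exponent honest.\<close>

lemma chi_sum_rec:
  assumes S: "finite S" "i \<in> S" "S \<noteq> {i}" and c: "c i \<noteq> 0"
  shows "chi_sum S c k - chi_sum S c (k - 1) / c i = chi_sum (S - {i}) c k"
proof -
  have fin: "finite (S - {i})" using S by simp
  have "S - {i} \<noteq> {}" using S by auto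
  then obtain m where m: "card (S - {i}) = Suc m"
    using fin by (metis card_gt_0_iff gr0_implies_Suc)
  have "card S = Suc (card (S - {i}))" using S by (intro card.remove)
  then have sgn: "(-1::complex) ^ (card S - 1) = - ((-1) ^ (card (S - {i}) - 1))"
    unfolding m by simp
  have rem: "(\<Sum>w\<in>npos_wts (S - {i}) k. char_on S c w) = (\<Sum>w\<in>npos_wts (S - {i}) k. char_on (S - {i}) c w)"
    "(\<Sum>w\<in>pos_wts (S - {i}) k. char_on S c w) = (\<Sum>w\<in>pos_wts (S - {i}) k. char_on (S - {i}) c w)"
    using S by (auto intro!: sum.cong char_on_remove simp: npos_wts_def pos_wts_def in_keys_iff)
  have "(\<Sum>w\<in>npos_wts S k. char_on S c w) = (\<Sum>w\<in>npos_wts (S - {i}) k. char_on (S - {i}) c w) +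
      (\<Sum>w\<in>npos_wts S (k - 1). char_on S c w) / c i"
    unfolding npos_wts_split(1)[OF S(1,2), of k] sum_char_on_shift[where c = c, OF S(1,2) c, symmetric] rem[symmetric]
    using S fin by (intro sum.union_disjoint npos_wts_split(2)) (auto simp: finite_npos_wts)
  moreover have "(\<Sum>w\<in>pos_wts S (k - 1). char_on S c w) / c i =
      (\<Sum>w\<in>pos_wts (S - {i}) k. char_on (S - {i}) c w) + (\<Sum>w\<in>pos_wts S k. char_on S c w)"
    unfolding sum_char_on_shift[where c = c, OF S(1,2) c, symmetric] pos_wts_split(1)[OF S(1,2)] rem[symmetric]
    using S fin by (intro sum.union_disjoint pos_wts_split(2)) (auto simp: finite_pos_wts)
  moreover have "(A + - s * B) - (A' + - s * B') / c i = A'' + s * B''"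
    if "A = A'' + A' / c i" "B' / c i = B'' + B" for A A' A'' B B' B'' s
  proof -
    have "(A' + - s * B') / c i = A' / c i - s * (B' / c i)"
      by (simp add: diff_divide_distrib)
    then show ?thesis unfolding that by (simp add: algebra_simps)
  qed
  ultimately show ?thesis
    unfolding chi_sum_def sgn by blast
qed

text \<open>The combination multiplies the l-th summand by 1 - c_l/c_i. This kills the summand l = i
  and cancels one denominator factor in each of the others.\<close>

lemma fixed_point_sum_rec:
  assumes S: "finite S" "i \<in> S" and c: "\<And>j. j \<in> S \<Longrightarrow> c j \<noteq> 0" "inj_on c S"
  shows "fixed_point_sum S c k - fixed_point_sum S c (k - 1) / c i = fixed_point_sum (S - {i}) c k"
proof -
  define P where "P l = (\<Prod>j\<in>S - {l}. 1 - c l / c j)" for l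
  have "fixed_point_sum S c k - fixed_point_sum S c (k - 1) / c i =
      (\<Sum>l\<in>S. c l powi (- k) / P l - (c l powi (- (k - 1)) / P l) / c i)"
    by (simp only: fixed_point_sum_def P_def sum_subtractf sum_divide_distrib)
  also have "\<dots> = (\<Sum>l\<in>S. c l powi (- k) * (1 - c l / c i) / P l)"
  proof (rule sum.cong[OF refl])
    fix l assume "l \<in> S"
    have "c l powi (- (k - 1)) = c l powi (- k) * c l"
      using c(1)[OF \<open>l \<in> S\<close>] power_int_add_1[of "c l" "- k"] by (simp add: algebra_simps)
    then show "c l powi (- k) / P l - c l powi (- (k - 1)) / P l / c i = c l powi (- k) * (1 - c l / c i) / P l"
      by (simp add: diff_divide_distrib right_diff_distrib)
  qed
  also have "\<dots> = (\<Sum>l\<in>S - {i}. c l powi (- k) * (1 - c l / c i) / P l)"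
    using S c by (simp add: sum.remove)
  also have "\<dots> = fixed_point_sum (S - {i}) c k"
    unfolding fixed_point_sum_def
  proof (rule sum.cong[OF refl])
    fix l assume l: "l \<in> S - {i}"
    have "P l = (1 - c l / c i) * (\<Prod>j\<in>S - {l} - {i}. 1 - c l / c j)"
      unfolding P_def using S l by (intro prod.remove) auto
    moreover have "S - {l} - {i} = S - {i} - {l}" by auto
    moreover have "1 - c l / c i \<noteq> 0"
      using l S c by (auto simp: inj_on_def)
    ultimately show "c l powi (- k) * (1 - c l / c i) / P l = c l powi (- k) / (\<Prod>j\<in>S - {i} - {l}. 1 - c l / c j)"
      by simp
  qed
  finally show ?thesis .
qed

lemma chi_sum_singleton:
  assumes "c i \<noteq> 0"
  shows "chi_sum {i} c k = c i powi (- k)"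
proof -
  have "w = Poly_Mapping.single i (- k)" if "Poly_Mapping.keys w \<subseteq> {i}" "Poly_Mapping.lookup w i = - k" for w :: wt
    using poly_mapping_keys_single[OF that(1)] that(2) by simp
  then have "npos_wts {i} k = (if k \<ge> 0 then {Poly_Mapping.single i (- k)} else {})"
    "pos_wts {i} k = (if k < 0 then {Poly_Mapping.single i (- k)} else {})"
    by (auto simp: npos_wts_def pos_wts_def split: if_splits)
  then show ?thesis by (auto simp: chi_sum_def char_on_def)
qed

text \<open>Both sides obey the same recursion for every \<open>i \<in> S\<close>; playing two indices off against
  each other determines the values from those for smaller sets.\<close>

theorem chi_sum_eq_fixed_point_sum:
  assumes "finite S" "S \<noteq> {}" "\<And>j. j \<in> S \<Longrightarrow> c j \<noteq> 0" "inj_on c S"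
  shows "chi_sum S c k = fixed_point_sum S c k"
  using assms
proof (induction "card S" arbitrary: S k rule: less_induct)
  case less
  show ?case
  proof (cases "\<exists>i. S = {i}")
    case True
    then show ?thesis using less by (auto simp: chi_sum_singleton fixed_point_sum_def)
  next
    case False
    from less obtain i where i: "i \<in> S" by auto
    with False obtain l where l: "l \<in> S" "l \<noteq> i" by auto
    have IH: "chi_sum (S - {j}) c k' = fixed_point_sum (S - {j}) c k'" if "j \<in> S" for j k'
    proof (rule less.hyps)
      show "card (S - {j}) < card S" using that less by (intro card_Diff1_less)
      show "S - {j} \<noteq> {}" using False that by auto
    qed (use less in \<open>auto intro: inj_on_subset\<close>)
    have rec: "chi_sum S c (k + 1) - chi_sum S c k / c j = fixed_point_sum S c (k + 1) - fixed_point_sum S c k / c j"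
      if "j \<in> S" for j
      using chi_sum_rec[of S j c "k + 1"] fixed_point_sum_rec[of S j c "k + 1"] IH[OF that] less that False by auto
    \<comment> \<open>For the difference d_k of the two sides the recursion reads d_k / c_j =
      d_(k+1), whose right side does not depend on j. Two distinct values of c_j then force d_k =
      0.\<close>
    have "chi_sum S c k / c j - fixed_point_sum S c k / c j = chi_sum S c (k + 1) - fixed_point_sum S c (k + 1)"
      if "j \<in> S" for j
      using rec[OF that] by (simp add: algebra_simps)
    then have "chi_sum S c k / c l - fixed_point_sum S c k / c l = chi_sum S c k / c i - fixed_point_sum S c k / c i"
      using i l by simp
    then have "(chi_sum S c k - fixed_point_sum S c k) * (1 / c l - 1 / c i) = 0"
      by (simp add: algebra_simps)
    moreover have "1 / c l - 1 / c i \<noteq> 0"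
      using less.prems i l by (auto simp: inj_on_def)
    ultimately show ?thesis by simp
  qed
qed

text \<open>Finite support is what allows \<open>H_char\<close> to be read off through
  \<open>Abs_poly_mapping\<close>.\<close>

lemma finite_H_mult:
  assumes "p < r"
  shows "finite {w. H_mult r k p w \<noteq> 0}"
proof (rule finite_subset)
  show "{w. H_mult r k p w \<noteq> 0} \<subseteq> npos_wts {..<r} k \<union> pos_wts {..<r} k"
    using assms by (auto simp: H_mult_eq npos_wts_def pos_wts_def wts_def split: if_splits)
  show "finite (npos_wts {..<r} k \<union> pos_wts {..<r} k)"
    by (simp add: finite_npos_wts finite_pos_wts)
qed

lemma lookup_chi_O:
  assumes "r > 0"
  shows "Poly_Mapping.lookup (chi_O r k) w =
    (if w \<in> npos_wts {..<r} k then 1 else 0) + (if w \<in> pos_wts {..<r} k then (-1) ^ (r - 1) else 0)"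
proof -
  have lookup_sign: "Poly_Mapping.lookup ((-1) ^ p * f) w = (-1) ^ p * Poly_Mapping.lookup f w" for p and f :: KA
    by (induction p) auto
  define A where "A \<longleftrightarrow> w \<in> npos_wts {..<r} k"
  define B where "B \<longleftrightarrow> w \<in> pos_wts {..<r} k"
  have "Poly_Mapping.lookup (chi_O r k) w = (\<Sum>p<r. (-1) ^ p * H_mult r k p w)"
    by (simp add: chi_O_def lookup_sum lookup_sign H_char_def finite_H_mult)
  also have "\<dots> = (\<Sum>p<r. (if p = 0 then (if A then 1 else 0) else 0) + (if p = r - 1 then (if B then (-1) ^ (r - 1) else 0) else 0))"
    by (rule sum.cong) (use assms in \<open>auto simp: H_mult_eq npos_wts_def pos_wts_def wts_def A_def B_def\<close>)
  also have "\<dots> = (if A then 1 else 0) + (if B then (-1) ^ (r - 1) else 0)"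
    using assms by (simp add: sum.distrib)
  finally show ?thesis by (simp add: A_def B_def)
qed

lemma keys_chi_O:
  assumes "r > 0"
  shows "Poly_Mapping.keys (chi_O r k) \<subseteq> wts r"
proof -
  have "Poly_Mapping.keys (chi_O r k) \<subseteq> npos_wts {..<r} k \<union> pos_wts {..<r} k"
    using assms by (auto simp: in_keys_iff lookup_chi_O split: if_splits)
  then show ?thesis by (auto simp: npos_wts_def pos_wts_def wts_def)
qed

section \<open>Evaluation of group ring elements, and localization for arbitrary classes\<close>

definition pm_eval :: "('a \<Rightarrow> complex) \<Rightarrow> ('a \<Rightarrow>\<^sub>0 int) \<Rightarrow> complex" where
  "pm_eval h f = (\<Sum>a\<in>Poly_Mapping.keys f. of_int (Poly_Mapping.lookup f a) * h a)"

lemma pm_eval_superset: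
  assumes "finite U" "Poly_Mapping.keys f \<subseteq> U"
  shows "pm_eval h f = (\<Sum>a\<in>U. of_int (Poly_Mapping.lookup f a) * h a)"
  unfolding pm_eval_def using assms by (intro sum.mono_neutral_left) (auto simp: in_keys_iff)

lemma pm_eval_0 [simp]: "pm_eval h 0 = 0"
  by (simp add: pm_eval_def)

lemma pm_eval_single [simp]: "pm_eval h (Poly_Mapping.single a n) = of_int n * h a"
  by (simp add: pm_eval_def)

lemma pm_eval_add: "pm_eval h (f + g) = pm_eval h f + pm_eval h g"
proof -
  let ?U = "Poly_Mapping.keys f \<union> Poly_Mapping.keys g"
  have "Poly_Mapping.keys (f + g) \<subseteq> ?U" by (rule keys_add)
  then show ?thesis
    by (simp add: pm_eval_superset[of ?U] lookup_add algebra_simps sum.distrib)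
qed

lemma pm_eval_uminus: "pm_eval h (- f) = - pm_eval h f"
  using pm_eval_add[of h f "- f"] by (simp add: eq_neg_iff_add_eq_0 add.commute)

lemma pm_eval_sum: "pm_eval h (sum f A) = (\<Sum>x\<in>A. pm_eval h (f x))"
  by (induction A rule: infinite_finite_induct) (auto simp: pm_eval_add)

lemma poly_mapping_sum_single:
  fixes f :: "'a \<Rightarrow>\<^sub>0 'b::comm_monoid_add"
  shows "f = (\<Sum>a\<in>Poly_Mapping.keys f. Poly_Mapping.single a (Poly_Mapping.lookup f a))"
  by (rule poly_mapping_eqI) (simp add: lookup_sum lookup_single when_def in_keys_iff)

text \<open>Stated for any multiplicative h, so that it serves both for evaluating \<open>KA\<close>
  at a torus element and for restricting a class to a coordinate line.\<close>

lemma pm_eval_mult: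
  assumes "\<And>a b. h (a + b) = h a * h b"
  shows "pm_eval h (f * g) = pm_eval h f * pm_eval h g"
proof -
  have "pm_eval h (f * g) = pm_eval h ((\<Sum>a\<in>Poly_Mapping.keys f. Poly_Mapping.single a (Poly_Mapping.lookup f a)) *
      (\<Sum>a\<in>Poly_Mapping.keys g. Poly_Mapping.single a (Poly_Mapping.lookup g a)))"
    by (simp flip: poly_mapping_sum_single)
  then show ?thesis
    by (simp add: sum_product mult_single pm_eval_sum assms) (simp add: pm_eval_def sum_product ac_simps)
qed

lemma KA_eval_eq: "KA_eval r c = pm_eval (\<lambda>w. wt_eval r w c)"
  by (simp add: KA_eval_def pm_eval_def fun_eq_iff)

lemma wt_eval_add:
  assumes "\<And>i. i < r \<Longrightarrow> c i \<noteq> 0"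
  shows "wt_eval r (v + w) c = wt_eval r v c * wt_eval r w c"
  using assms by (simp add: wt_eval_def lookup_add power_int_add prod.distrib)

lemma KA_eval_chi_O:
  assumes r: "r > 0" and c: "\<And>i. i < r \<Longrightarrow> c i \<noteq> 0" "inj_on c {..<r}"
  shows "KA_eval r c (chi_O r k) = fixed_point_sum {..<r} c k"
proof -
  let ?A = "npos_wts {..<r} k" and ?B = "pos_wts {..<r} k"
  have fin: "finite ?A" "finite ?B" by (simp_all add: finite_npos_wts finite_pos_wts)
  have ev: "wt_eval r w c = char_on {..<r} c w" for w by (simp add: wt_eval_def char_on_def)
  have "KA_eval r c (chi_O r k) = (\<Sum>w\<in>?A \<union> ?B. of_int (Poly_Mapping.lookup (chi_O r k) w) * wt_eval r w c)"
    unfolding KA_eval_eq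
    by (rule pm_eval_superset) (use r fin in \<open>auto simp: in_keys_iff lookup_chi_O split: if_splits\<close>)
  also have "\<dots> = (\<Sum>w\<in>?A \<union> ?B. (if w \<in> ?A then char_on {..<r} c w else 0)) +
      (\<Sum>w\<in>?A \<union> ?B. (if w \<in> ?B then (-1) ^ (r - 1) * char_on {..<r} c w else 0))"
    unfolding sum.distrib[symmetric] by (rule sum.cong) (auto simp: lookup_chi_O[OF r] ev algebra_simps)
  also have "(\<Sum>w\<in>?A \<union> ?B. (if w \<in> ?A then char_on {..<r} c w else 0)) = (\<Sum>w\<in>?A. char_on {..<r} c w)"
    using fin by (intro sum.mono_neutral_cong_right) auto
  also have "(\<Sum>w\<in>?A \<union> ?B. (if w \<in> ?B then (-1) ^ (r - 1) * char_on {..<r} c w else 0)) =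
      (\<Sum>w\<in>?B. (-1) ^ (r - 1) * char_on {..<r} c w)"
    using fin by (intro sum.mono_neutral_cong_right) auto
  also have "(\<Sum>w\<in>?A. char_on {..<r} c w) + (\<Sum>w\<in>?B. (-1) ^ (r - 1) * char_on {..<r} c w) = chi_sum {..<r} c k"
    by (simp add: chi_sum_def sum_distrib_left)
  also have "\<dots> = fixed_point_sum {..<r} c k"
    using r c by (intro chi_sum_eq_fixed_point_sum) auto
  finally show ?thesis .
qed

lemma KAy_eval_superset:
  assumes "finite U" "Poly_Mapping.keys g \<subseteq> U"
  shows "KAy_eval r c y g = (\<Sum>l\<in>U. KA_eval r c (Poly_Mapping.lookup g l) * y powi l)"
  unfolding KAy_eval_def using assms
  by (intro sum.mono_neutral_left) (auto simp: in_keys_iff KA_eval_eq)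

lemma KAy_eval_add: "KAy_eval r c y (f + g) = KAy_eval r c y f + KAy_eval r c y g"
proof -
  let ?U = "Poly_Mapping.keys f \<union> Poly_Mapping.keys g"
  have "Poly_Mapping.keys (f + g) \<subseteq> ?U" by (rule keys_add)
  then show ?thesis
    by (simp add: KAy_eval_superset[of ?U] lookup_add algebra_simps sum.distrib KA_eval_eq pm_eval_add)
qed

lemma KAy_eval_0 [simp]: "KAy_eval r c y 0 = 0"
  by (simp add: KAy_eval_def)

lemma KAy_eval_sum: "KAy_eval r c y (sum f A) = (\<Sum>x\<in>A. KAy_eval r c y (f x))"
  by (induction A rule: infinite_finite_induct) (auto simp: KAy_eval_add)

lemma KAy_eval_single [simp]: "KAy_eval r c y (Poly_Mapping.single l f) = KA_eval r c f * y powi l"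
  by (simp add: KAy_eval_def KA_eval_eq)

text \<open>The restriction of a class to the \<open>i\<close>-th coordinate line, where \<open>\<O>(1)\<close> has the weight
  \<open>c\<^sub>i\<^sup>-\<^sup>1\<close>.\<close>

definition restrict_fixed :: "nat \<Rightarrow> (nat \<Rightarrow> complex) \<Rightarrow> complex \<Rightarrow> nat \<Rightarrow> line \<Rightarrow> complex" where
  "restrict_fixed r c y i = (\<lambda>(k, l, w). c i powi (- k) * y powi l * wt_eval r w c)"

text \<open>Both sides are additive in F. For a single line bundle the factors w and y^l come out of
  the Euler characteristic, leaving the fixed point formula for O(k).\<close>

theorem localization:
  assumes r: "r > 0" and c: "\<And>i. i < r \<Longrightarrow> c i \<noteq> 0" "inj_on c {..<r}"
  shows "KAy_eval r c y (chi_P r F) =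
    (\<Sum>i<r. pm_eval (restrict_fixed r c y i) F / (\<Prod>j\<in>{..<r} - {i}. 1 - c i / c j))"
proof -
  have "KAy_eval r c y (chi_P r F) = (\<Sum>(k, l, w)\<in>Poly_Mapping.keys F.
      of_int (Poly_Mapping.lookup F (k, l, w)) * wt_eval r w c * fixed_point_sum {..<r} c k * y powi l)"
    unfolding chi_P_def KAy_eval_sum
    by (rule sum.cong) (use c in \<open>auto simp: KA_eval_eq pm_eval_mult wt_eval_add
        KA_eval_chi_O[OF r c, unfolded KA_eval_eq]\<close>)
  also have "\<dots> = (\<Sum>x\<in>Poly_Mapping.keys F. \<Sum>i<r. of_int (Poly_Mapping.lookup F x) *
      restrict_fixed r c y i x / (\<Prod>j\<in>{..<r} - {i}. 1 - c i / c j))"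
    by (rule sum.cong)
      (auto simp: restrict_fixed_def fixed_point_sum_def sum_distrib_left sum_distrib_right intro!: sum.cong)
  also have "\<dots> = (\<Sum>i<r. pm_eval (restrict_fixed r c y i) F / (\<Prod>j\<in>{..<r} - {i}. 1 - c i / c j))"
    unfolding pm_eval_def sum_divide_distrib by (rule sum.swap)
  finally show ?thesis .
qed

section \<open>The infinite product as a function and as a power series\<close>

lemma convergent_prod_phi:
  fixes q :: complex
  assumes "norm q < 1"
  shows "convergent_prod (\<lambda>n. 1 - q ^ Suc n * z)"
proof (intro abs_convergent_prod_imp_convergent_prod summable_imp_abs_convergent_prod)
  have "summable (\<lambda>n. norm q ^ Suc n * norm z)"
    using assms by (intro summable_mult2 summable_ignore_initial_segment[of _ 1, simplified] summable_geometric) auto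
  then show "summable (\<lambda>n. norm (1 - q ^ Suc n * z - 1))"
    by (simp add: norm_mult norm_power)
qed

lemma phi_tendsto:
  fixes q :: complex
  assumes "norm q < 1"
  shows "(\<lambda>N. \<Prod>n<N. 1 - q ^ Suc n * z) \<longlonglongrightarrow> phi q z"
  using convergent_prod_LIMSEQ[OF convergent_prod_phi[OF assms, of z]]
  unfolding phi_def by (subst LIMSEQ_lessThan_iff_atMost)

lemma phi_nonzero:
  fixes q :: complex
  assumes "norm q < 1" "\<And>n. n > 0 \<Longrightarrow> q ^ n * z \<noteq> 1"
  shows "phi q z \<noteq> 0"
  unfolding phi_def
proof (rule prodinf_nonzero[OF convergent_prod_phi[OF assms(1)]])
  show "1 - q ^ Suc n * z \<noteq> 0" for n
    using assms(2)[of "Suc n"] by simp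
qed

text \<open>Both arguments vary: q is the variable when power series are compared, z when the
  contour integral is studied. On a compact set |q| attains its maximum, which is therefore still
  below 1 and gives a geometric majorant.\<close>

lemma uniform_limit_phi:
  fixes q z :: "complex \<Rightarrow> complex"
  assumes K: "compact K" and cont: "continuous_on K q" "continuous_on K z"
    and q: "\<And>x. x \<in> K \<Longrightarrow> norm (q x) < 1"
  shows "uniform_limit K (\<lambda>N x. \<Prod>n<N. 1 - q x ^ Suc n * z x) (\<lambda>x. phi (q x) (z x)) sequentially"
proof (cases "K = {}")
  case False
  have "continuous_on K (\<lambda>x. norm (q x))" using cont by (intro continuous_intros)
  then obtain x0 where x0: "x0 \<in> K" "\<And>x. x \<in> K \<Longrightarrow> norm (q x) \<le> norm (q x0)"
    using continuous_attains_sup[OF K False] by blast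
  have "continuous_on K (\<lambda>x. norm (z x))" using cont by (intro continuous_intros)
  then obtain x1 where x1: "\<And>x. x \<in> K \<Longrightarrow> norm (z x) \<le> norm (z x1)"
    using continuous_attains_sup[OF K False] by blast
  have "uniformly_convergent_on K (\<lambda>N x. \<Prod>n<N. 1 + - (q x ^ Suc n * z x))"
  proof (rule uniformly_convergent_on_prod)
    show "continuous_on K (\<lambda>x. - (q x ^ Suc n * z x))" for n
      using cont by (intro continuous_intros)
    show "uniformly_convergent_on K (\<lambda>N x. \<Sum>n<N. norm (- (q x ^ Suc n * z x)))"
    proof (rule Weierstrass_m_test'_ev)
      show "\<forall>\<^sub>F n in sequentially. \<forall>x\<in>K. norm (norm (- (q x ^ Suc n * z x))) \<le> norm (q x0) ^ Suc n * norm (z x1)"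
        using x0 x1 by (intro always_eventually allI ballI)
          (auto simp: norm_mult norm_power intro!: mult_mono power_mono)
      show "summable (\<lambda>n. norm (q x0) ^ Suc n * norm (z x1))"
        using q[OF x0(1)] by (auto intro!: summable_mult summable_mult2 summable_geometric)
    qed
  qed (rule K)
  then obtain l where l: "uniform_limit K (\<lambda>N x. \<Prod>n<N. 1 - q x ^ Suc n * z x) l sequentially"
    by (auto simp: uniformly_convergent_on_def)
  have "l x = phi (q x) (z x)" if "x \<in> K" for x
    using LIMSEQ_unique[OF tendsto_uniform_limitI[OF l that] phi_tendsto[OF q[OF that]]] .
  then show ?thesis
    using l by (simp cong: uniform_limit_cong')
qed auto

lemma holomorphic_on_phi:
  fixes q z :: "complex \<Rightarrow> complex"
  assumes S: "open S" and hol: "q holomorphic_on S" "z holomorphic_on S"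
    and q: "\<And>x. x \<in> S \<Longrightarrow> norm (q x) < 1"
  shows "(\<lambda>x. phi (q x) (z x)) holomorphic_on S"
proof (rule holomorphic_uniform_sequence[OF S])
  show "(\<lambda>x. \<Prod>n<N. 1 - q x ^ Suc n * z x) holomorphic_on S" for N
    using hol by (intro holomorphic_intros)
  fix x assume "x \<in> S"
  then obtain d where d: "d > 0" "cball x d \<subseteq> S"
    using S open_contains_cball by blast
  have "uniform_limit (cball x d) (\<lambda>N x. \<Prod>n<N. 1 - q x ^ Suc n * z x) (\<lambda>x. phi (q x) (z x)) sequentially"
    using d hol q
    by (intro uniform_limit_phi) (auto intro!: holomorphic_on_imp_continuous_on intro: holomorphic_on_subset)
  with d show "\<exists>d>0. cball x d \<subseteq> S \<and>
      uniform_limit (cball x d) (\<lambda>N x. \<Prod>n<N. 1 - q x ^ Suc n * z x) (\<lambda>x. phi (q x) (z x)) sequentially"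
    by blast
qed

text \<open>The factor with index n differs from 1 only by a multiple of the power n + 1 of
  \<open>fps_X\<close>, so each coefficient of the partial products stabilises. This is the only
  access to the formal \<open>phi\<close> used later.\<close>

lemma fps_phi_nth:
  fixes z :: "'a::comm_ring_1 fps"
  assumes "d \<le> N"
  shows "fps_nth (phi fps_X z) d = fps_nth (\<Prod>n<Suc N. 1 - fps_X ^ Suc n * z) d"
proof -
  define P where "P N = (\<Prod>n<Suc N. 1 - fps_X ^ Suc n * z)" for N
  have stable: "fps_nth (P N) d = fps_nth (P d) d" if "d \<le> N" for d N
    using that
  proof (induction N rule: dec_induct)
    case (step N)
    have "P (Suc N) = P N - fps_X ^ Suc (Suc N) * (z * P N)"
      unfolding P_def by (subst (1) prod.lessThan_Suc) (simp only: left_diff_distrib right_diff_distrib mult_1_left mult_1_right ac_simps)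
    then have "fps_nth (P (Suc N)) d = fps_nth (P N) d"
      using step(1) by (simp only: fps_sub_nth fps_X_power_mult_nth) simp
    with step.IH show ?case by simp
  qed simp
  define L where "L = Abs_fps (\<lambda>d. fps_nth (P d) d)"
  have lim: "P \<longlonglongrightarrow> L"
  proof (rule tendsto_fpsI)
    show "\<forall>\<^sub>F N in sequentially. fps_nth (P N) d = fps_nth L d" for d
      using eventually_ge_at_top[of d] by eventually_elim (auto simp: L_def dest: stable)
  qed
  have const: "fps_nth (1 - fps_X ^ Suc n * z) 0 = 1" for n
    by (simp only: fps_sub_nth fps_X_power_mult_nth) simp
  have "P 0 = 1 - fps_X ^ Suc 0 * z"
    by (simp only: P_def prod.lessThan_Suc lessThan_0 prod.empty mult_1_left)
  then have "fps_nth L 0 = 1" using const[of 0] by (simp add: L_def)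
  \<comment> \<open>\<open>raw_has_prod\<close> demands a nonzero limit.\<close>
  then have "L \<noteq> 0" by auto
  then have raw: "raw_has_prod (\<lambda>n. 1 - fps_X ^ Suc n * z) 0 L"
    using lim unfolding raw_has_prod_def P_def lessThan_Suc_atMost add_0_right by blast
  have "prodinf (\<lambda>n. 1 - fps_X ^ Suc n * z) = L"
    unfolding prodinf_def
  proof (rule the_equality)
    show "(\<lambda>n. 1 - fps_X ^ Suc n * z) has_prod L"
      using raw unfolding has_prod_def ..
    fix L' assume "(\<lambda>n. 1 - fps_X ^ Suc n * z) has_prod L'"
    \<comment> \<open>\<open>has_prod\<close> also admits the value 0 when some factor vanishes. The
      constant term 1 excludes this, so any candidate value is a limit of the partial products, and
      limits are unique.\<close>
    moreover have "1 - fps_X ^ Suc n * z \<noteq> 0" for n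
    proof
      assume "1 - fps_X ^ Suc n * z = 0"
      then have "fps_nth (1 - fps_X ^ Suc n * z) 0 = 0" by simp
      then show False unfolding const by simp
    qed
    ultimately have "raw_has_prod (\<lambda>n. 1 - fps_X ^ Suc n * z) 0 L'"
      unfolding has_prod_def by blast
    with raw show "L' = L"
      unfolding raw_has_prod_def using LIMSEQ_unique by blast
  qed
  then show ?thesis
    using stable[OF assms] by (simp add: phi_def L_def P_def)
qed

lemma fps_phi_nth_0 [simp]: "fps_nth (phi fps_X (z::'a::comm_ring_1 fps)) 0 = 1"
proof -
  have "fps_nth (phi fps_X z) 0 = fps_nth (1 - fps_X ^ Suc 0 * z) 0"
    using fps_phi_nth[of 0 0 z] by (simp only: prod.lessThan_Suc lessThan_0 prod.empty mult_1_left order.refl simp_thms)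
  also have "\<dots> = 1" by (simp only: fps_sub_nth fps_X_power_mult_nth) simp
  finally show ?thesis .
qed

text \<open>Derivatives at 0 pass to the locally uniform limit of the partial products, while the
  d-th derivative of these is constant from index d + 1 on and equals the formal coefficient times
  d!.\<close>

lemma phi_has_fps_expansion:
  fixes z :: complex
  shows "(\<lambda>q. phi q z) has_fps_expansion phi fps_X (fps_const z)"
proof -
  have hol: "(\<lambda>q. phi q z) holomorphic_on ball 0 1"
    by (rule holomorphic_on_phi) auto
  then have exp: "(\<lambda>q. phi q z) has_fps_expansion fps_expansion (\<lambda>q. phi q z) 0"
    by (intro has_fps_expansion_fps_expansion[where A = "ball 0 1"]) auto
  have "fps_nth (fps_expansion (\<lambda>q. phi q z) 0) d = fps_nth (phi fps_X (fps_const z)) d" for d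
  proof -
    define p where "p N q = (\<Prod>n<N. 1 - q ^ Suc n * z)" for N and q :: complex
    have p_exp: "p N has_fps_expansion (\<Prod>n<N. 1 - fps_X ^ Suc n * fps_const z)" for N
      unfolding p_def[abs_def] by (intro fps_expansion_intros)
    have "(\<lambda>N. (deriv ^^ d) (p N) 0) \<longlonglongrightarrow> (deriv ^^ d) (\<lambda>q. phi q z) 0"
    proof (rule higher_deriv_complex_uniform_limit)
      have "uniform_limit (cball 0 (1/2)) p (\<lambda>q. phi q z) sequentially"
        unfolding p_def[abs_def] by (intro uniform_limit_phi) auto
      then show "uniform_limit (ball 0 (1/2)) p (\<lambda>q. phi q z) sequentially"
        by (rule uniform_limit_on_subset) auto
      show "\<forall>\<^sub>F N in sequentially. p N holomorphic_on ball 0 (1/2)"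
        unfolding p_def[abs_def] by (intro always_eventually allI holomorphic_intros)
    qed auto
    moreover have "(\<lambda>N. (deriv ^^ d) (p N) 0) \<longlonglongrightarrow> fact d * fps_nth (phi fps_X (fps_const z)) d"
    proof (rule tendsto_eventually)
      show "\<forall>\<^sub>F N in sequentially. (deriv ^^ d) (p N) 0 = fact d * fps_nth (phi fps_X (fps_const z)) d"
        using eventually_gt_at_top[of d]
      proof eventually_elim
        fix N assume "d < N"
        then obtain M where M: "N = Suc M" "d \<le> M" by (metis Suc_le_eq Suc_pred' gr0I less_Suc_eq_le not_less_zero)
        have "fps_nth (\<Prod>n<N. 1 - fps_X ^ Suc n * fps_const z) d = (deriv ^^ d) (p N) 0 / fact d"
          by (rule fps_nth_fps_expansion[OF p_exp])
        then show "(deriv ^^ d) (p N) 0 = fact d * fps_nth (phi fps_X (fps_const z)) d"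
          using fps_phi_nth[OF M(2), of "fps_const z"] by (simp add: M(1))
      qed
    qed
    ultimately have "(deriv ^^ d) (\<lambda>q. phi q z) 0 = fact d * fps_nth (phi fps_X (fps_const z)) d"
      by (rule LIMSEQ_unique)
    then show ?thesis by (simp add: fps_expansion_def)
  qed
  then have "fps_expansion (\<lambda>q. phi q z) 0 = phi fps_X (fps_const z)" by (rule fps_ext)
  with exp show ?thesis by simp
qed

section \<open>Restriction of power series of classes\<close>

definition fps_pm_eval :: "('a \<Rightarrow> complex) \<Rightarrow> ('a \<Rightarrow>\<^sub>0 int) fps \<Rightarrow> complex fps" where
  "fps_pm_eval h F = Abs_fps (\<lambda>d. pm_eval h (fps_nth F d))"

lemma fps_nth_pm_eval [simp]: "fps_nth (fps_pm_eval h F) d = pm_eval h (fps_nth F d)"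
  by (simp add: fps_pm_eval_def)

lemma restrict_fixed_0 [simp]: "restrict_fixed r c y i 0 = 1"
  by (simp add: restrict_fixed_def zero_prod_def wt_eval_def)

lemma restrict_fixed_add:
  assumes "i < r" "\<And>j. j < r \<Longrightarrow> c j \<noteq> 0" "y \<noteq> 0"
  shows "restrict_fixed r c y i (L + M) = restrict_fixed r c y i L * restrict_fixed r c y i M"
  using assms by (cases L; cases M)
    (auto simp: restrict_fixed_def wt_eval_add power_int_add power_int_minus algebra_simps)

locale character =
  fixes h :: "'a::ab_group_add \<Rightarrow> complex"
  assumes h_0: "h 0 = 1" and h_add: "h (a + b) = h a * h b"
begin

lemma h_uminus: "h (- a) = inverse (h a)"
  using h_add[of a "- a"] h_0 by (metis inverse_unique right_minus)

lemma fps_pm_eval_mult: "fps_pm_eval h (F * G) = fps_pm_eval h F * fps_pm_eval h G"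
  by (rule fps_ext) (simp add: fps_mult_nth pm_eval_sum pm_eval_mult h_add)

lemma pm_eval_1: "pm_eval h 1 = 1"
  using pm_eval_single[of h 0 1] by (simp add: h_0)

lemma fps_pm_eval_1: "fps_pm_eval h 1 = 1"
  by (rule fps_ext) (simp add: pm_eval_1)

lemma fps_pm_eval_diff: "fps_pm_eval h (F - G) = fps_pm_eval h F - fps_pm_eval h G"
  using pm_eval_add[of h] pm_eval_uminus[of h]
  by (intro fps_ext) (simp add: diff_conv_add_uminus del: add_uminus_conv_diff)

lemma fps_pm_eval_X: "fps_pm_eval h fps_X = fps_X"
  by (rule fps_ext) (simp add: fps_X_def pm_eval_1)

lemma fps_pm_eval_power: "fps_pm_eval h (F ^ n) = fps_pm_eval h F ^ n"
  by (induction n) (simp_all add: fps_pm_eval_1 fps_pm_eval_mult)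

lemma fps_pm_eval_prod: "fps_pm_eval h (prod F A) = (\<Prod>x\<in>A. fps_pm_eval h (F x))"
  by (induction A rule: infinite_finite_induct) (simp_all add: fps_pm_eval_1 fps_pm_eval_mult)

lemma fps_pm_eval_prod_mset:
  "fps_pm_eval h (\<Prod>x\<in>#M. F x) = (\<Prod>x\<in>#M. fps_pm_eval h (F x))"
  by (induction M) (simp_all add: fps_pm_eval_1 fps_pm_eval_mult)

text \<open>Each coefficient of the infinite product is already a coefficient of a finite one, so no
  continuity of the evaluation has to be discussed.\<close>

lemma fps_pm_eval_phi: "fps_pm_eval h (phi fps_X Z) = phi fps_X (fps_pm_eval h Z)"
proof (rule fps_ext)
  fix d
  have "fps_nth (fps_pm_eval h (phi fps_X Z)) d = fps_nth (fps_pm_eval h (\<Prod>n<Suc d. 1 - fps_X ^ Suc n * Z)) d"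
    using fps_phi_nth[of d d Z] by simp
  also have "\<dots> = fps_nth (\<Prod>n<Suc d. 1 - fps_X ^ Suc n * fps_pm_eval h Z) d"
    by (simp only: fps_pm_eval_prod fps_pm_eval_diff fps_pm_eval_1 fps_pm_eval_mult fps_pm_eval_power fps_pm_eval_X)
  also have "\<dots> = fps_nth (phi fps_X (fps_pm_eval h Z)) d"
    by (simp only: fps_phi_nth[of d d] order.refl)
  finally show "fps_nth (fps_pm_eval h (phi fps_X Z)) d = fps_nth (phi fps_X (fps_pm_eval h Z)) d" .
qed

text \<open>The formal inverse lives over a ring that is not a field. Its defining equation survives
  evaluation, and over the complex numbers it determines the inverse.\<close>

lemma fps_pm_eval_right_inverse:
  assumes "fps_nth F 0 = 1"
  shows "fps_pm_eval h (fps_right_inverse F 1) = inverse (fps_pm_eval h F)"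
proof -
  have "F * fps_right_inverse F 1 = 1" using assms by (intro fps_right_inverse) simp
  then have "fps_pm_eval h F * fps_pm_eval h (fps_right_inverse F 1) = 1"
    by (metis fps_pm_eval_mult fps_pm_eval_1)
  then show ?thesis by (metis fps_inverse_unique)
qed

end

context
  fixes h :: "line \<Rightarrow> complex"
  assumes h: "character h"
begin

interpretation character h by (rule h)

lemma fps_pm_eval_cls: "fps_pm_eval h (cls L) = fps_const (h L)"
  by (rule fps_ext) (simp add: cls_def)

lemma fps_pm_eval_Phi: "fps_pm_eval h (Phi E) = (\<Prod>L\<in>#E. phi fps_X (fps_const (h L)))"
  by (simp add: Phi_def fps_pm_eval_prod_mset fps_pm_eval_phi fps_pm_eval_cls)

lemma fps_pm_eval_Theta:
  "fps_pm_eval h (Theta E) = (\<Prod>L\<in>#E. (1 - fps_const (inverse (h L))) * phi fps_X (fps_const (h L)) *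
     phi fps_X (fps_const (inverse (h L))))"
  by (simp add: Theta_def fps_pm_eval_prod_mset fps_pm_eval_phi fps_pm_eval_cls fps_pm_eval_mult
      fps_pm_eval_diff fps_pm_eval_1 h_uminus)

lemma Phi_nth_0: "fps_nth (Phi E) 0 = 1"
  by (induction E) (simp_all add: Phi_def)

lemma fps_pm_eval_C_class:
  fixes rp rm n
  defines "e \<equiv> (\<lambda>j. y_line (if j < rp then 1 else - 1))"
  defines "z \<equiv> (\<lambda>j. h (O_line 1 + coord_line j))"
  shows "fps_pm_eval h (C_class rp rm n) = fps_const (h (O_line n)) *
    (\<Prod>j<rp + rm. (1 - fps_const (inverse (h (e j) * z j))) * phi fps_X (fps_const (h (e j) * z j)) *
       phi fps_X (fps_const (inverse (h (e j) * z j)))) *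
    inverse (\<Prod>j<rp + rm. phi fps_X (fps_const (z j)) * phi fps_X (fps_const (inverse (z j))))"
proof -
  define T where "T u = (1 - fps_const (inverse u)) * phi fps_X (fps_const u) * phi fps_X (fps_const (inverse u))"
    for u :: complex
  define V where "V = V_plus rp + V_minus rp rm"
  have split: "(\<Prod>j<rp + rm. f j) = (\<Prod>j<rp. f j) * (\<Prod>j=rp..<rp + rm. f j)" for f :: "nat \<Rightarrow> complex fps"
    by (subst prod.union_disjoint[symmetric]) (auto intro!: prod.cong)
  have V_prod: "(\<Prod>L\<in>#twist M (V_plus rp) + twist N (V_minus rp rm). f L) =
      (\<Prod>j<rp + rm. f ((if j < rp then M else N) + coord_line j))" for f :: "line \<Rightarrow> complex fps" and M N
    by (simp add: split twist_def V_plus_def V_minus_def multiset.map_comp o_def atLeast0LessThan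
        flip: prod_unfold_prod_mset)
  have "fps_pm_eval h (Theta (twist (y_line 1 + O_line 1) (V_plus rp) + twist (y_line (- 1) + O_line 1) (V_minus rp rm)))
      = (\<Prod>j<rp + rm. T (h (e j) * z j))"
    unfolding fps_pm_eval_Theta T_def[symmetric] V_prod
    by (rule prod.cong) (auto simp: e_def z_def h_add mult.assoc)
  moreover have "fps_pm_eval h (Phi (twist (O_line 1) V)) = (\<Prod>j<rp + rm. phi fps_X (fps_const (z j)))"
    using V_prod[of _ "O_line 1" "O_line 1"]
    by (simp add: fps_pm_eval_Phi V_def z_def twist_def)
  \<comment> \<open>The Chern roots of the second bundle are the negatives of those of the first, so
    they evaluate to the inverses of the z_j.\<close>
  moreover have "twist (O_line (- 1)) (dual_bundle V) = image_mset uminus (twist (O_line 1) V)"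
    by (simp add: twist_def dual_bundle_def multiset.map_comp o_def O_line_def)
  then have "fps_pm_eval h (Phi (twist (O_line (- 1)) (dual_bundle V))) =
      (\<Prod>j<rp + rm. phi fps_X (fps_const (inverse (z j))))"
    using V_prod[of "\<lambda>L. phi fps_X (fps_const (inverse (h L)))" "O_line 1" "O_line 1"]
    by (simp add: fps_pm_eval_Phi V_def z_def twist_def multiset.map_comp o_def h_uminus
        del: minus_add_distrib)
  moreover have "fps_nth (Phi (twist (O_line 1) V) * Phi (twist (O_line (- 1)) (dual_bundle V))) 0 = 1"
    by (simp add: Phi_nth_0)
  ultimately show ?thesis
    unfolding C_class_def Let_def V_def[symmetric] fps_pm_eval_mult T_def[symmetric]
    by (simp only: fps_pm_eval_right_inverse fps_pm_eval_mult fps_pm_eval_cls prod.distrib)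
qed

end

section \<open>Series whose coefficients involve only characters of the rank r torus\<close>

definition fps_supported :: "'a set \<Rightarrow> ('a \<Rightarrow>\<^sub>0 int) fps set" where
  "fps_supported S = {F. \<forall>d. Poly_Mapping.keys (fps_nth F d) \<subseteq> S}"

context
  fixes S :: "'a::comm_monoid_add set"
  assumes zero: "0 \<in> S" and add: "\<And>a b. a \<in> S \<Longrightarrow> b \<in> S \<Longrightarrow> a + b \<in> S"
begin

lemma keys_mult_supported:
  fixes f g :: "'a \<Rightarrow>\<^sub>0 int"
  assumes "Poly_Mapping.keys f \<subseteq> S" "Poly_Mapping.keys g \<subseteq> S"
  shows "Poly_Mapping.keys (f * g) \<subseteq> S"
  using keys_mult[of f g] assms add by blast

lemma keys_sum_supported:
  fixes f :: "'b \<Rightarrow> 'a \<Rightarrow>\<^sub>0 int"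
  assumes "\<And>x. x \<in> A \<Longrightarrow> Poly_Mapping.keys (f x) \<subseteq> S"
  shows "Poly_Mapping.keys (sum f A) \<subseteq> S"
  using keys_sum[of f A] assms by blast

lemma fps_supported_mult: "F \<in> fps_supported S \<Longrightarrow> G \<in> fps_supported S \<Longrightarrow> F * G \<in> fps_supported S"
  unfolding fps_supported_def fps_mult_nth mem_Collect_eq
  by (intro allI keys_sum_supported keys_mult_supported) blast+

lemma fps_supported_1: "1 \<in> fps_supported S"
  by (auto simp: fps_supported_def zero)

lemma fps_supported_X: "fps_X \<in> fps_supported S"
  by (auto simp: fps_supported_def fps_X_def zero)

lemma fps_supported_diff: "F \<in> fps_supported S \<Longrightarrow> G \<in> fps_supported S \<Longrightarrow> F - G \<in> fps_supported S"
  unfolding fps_supported_def using keys_diff[of "fps_nth F d" "fps_nth G d" for d] by fastforce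

lemma fps_supported_power: "F \<in> fps_supported S \<Longrightarrow> F ^ n \<in> fps_supported S"
  by (induction n) (auto simp: fps_supported_1 fps_supported_mult)

lemma fps_supported_prod: "(\<And>x. x \<in> A \<Longrightarrow> F x \<in> fps_supported S) \<Longrightarrow> prod F A \<in> fps_supported S"
  by (induction A rule: infinite_finite_induct) (auto simp: fps_supported_1 fps_supported_mult)

lemma fps_supported_prod_mset:
  "(\<And>x. x \<in># M \<Longrightarrow> F x \<in> fps_supported S) \<Longrightarrow> (\<Prod>x\<in>#M. F x) \<in> fps_supported S"
  by (induction M) (auto simp: fps_supported_1 fps_supported_mult)

lemma fps_supported_phi:
  assumes "Z \<in> fps_supported S"
  shows "phi fps_X Z \<in> fps_supported S"
proof -
  have "(\<Prod>n<Suc d. 1 - fps_X ^ Suc n * Z) \<in> fps_supported S" for d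
    using assms
    by (intro fps_supported_prod fps_supported_diff fps_supported_mult fps_supported_power
        fps_supported_1 fps_supported_X)
  then have "Poly_Mapping.keys (fps_nth (\<Prod>n<Suc d. 1 - fps_X ^ Suc n * Z) d) \<subseteq> S" for d
    unfolding fps_supported_def by blast
  then show ?thesis
    unfolding fps_supported_def using fps_phi_nth[of d d Z for d] by auto
qed

text \<open>With constant term 1, each coefficient of the inverse is built from earlier ones by sums
  and products alone, so it never leaves the span of the submonoid S.\<close>

lemma fps_supported_right_inverse:
  assumes "F \<in> fps_supported S"
  shows "fps_right_inverse F 1 \<in> fps_supported S"
proof -
  have "Poly_Mapping.keys (fps_right_inverse_constructor F 1 n) \<subseteq> S" for n
  proof (induction n rule: less_induct)
    case (less n)
    show ?case
    proof (cases "n = 0")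
      case True
      then show ?thesis using zero by simp
    next
      case False
      then have "fps_right_inverse_constructor F 1 n =
          - (\<Sum>i = 1..n. fps_nth F i * fps_right_inverse_constructor F 1 (n - i))"
        by (subst fps_right_inverse_constructor_rec) auto
      moreover have "Poly_Mapping.keys (\<Sum>i = 1..n. fps_nth F i * fps_right_inverse_constructor F 1 (n - i)) \<subseteq> S"
        using assms less False
        by (intro keys_sum_supported keys_mult_supported) (auto simp: fps_supported_def)
      ultimately show ?thesis by simp
    qed
  qed
  then show ?thesis by (simp add: fps_supported_def)
qed

end

definition wt_lines :: "nat \<Rightarrow> line set" where
  "wt_lines r = {L. snd (snd L) \<in> wts r}"

lemma wts_0: "0 \<in> wts r"
  by (simp add: wts_def)

lemma wts_add: "v \<in> wts r \<Longrightarrow> w \<in> wts r \<Longrightarrow> v + w \<in> wts r"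
  by (simp add: wts_def keys_subset_iff lookup_add)

lemma wt_lines_0: "0 \<in> wt_lines r"
  by (simp add: wt_lines_def wts_0)

lemma wt_lines_add: "L \<in> wt_lines r \<Longrightarrow> M \<in> wt_lines r \<Longrightarrow> L + M \<in> wt_lines r"
  by (simp add: wt_lines_def wts_add)

lemma wt_lines_uminus: "L \<in> wt_lines r \<Longrightarrow> - L \<in> wt_lines r"
  by (simp add: wt_lines_def wts_def keys_subset_iff)

lemma fps_supported_cls: "L \<in> S \<Longrightarrow> cls L \<in> fps_supported S"
  by (auto simp: fps_supported_def cls_def)

lemma C_class_supported: "C_class rp rm n \<in> fps_supported (wt_lines (rp + rm))"
proof -
  note closed = wt_lines_0[of "rp + rm"] wt_lines_add[of _ "rp + rm"]
  have line: "O_line k \<in> wt_lines (rp + rm)" "y_line k \<in> wt_lines (rp + rm)" for k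
    by (simp_all add: O_line_def y_line_def wt_lines_def wts_0)
  have coord: "coord_line j \<in> wt_lines (rp + rm)" if "j < rp + rm" for j
    using that by (simp add: coord_line_def wt_lines_def wts_def)
  have Phi: "Phi E \<in> fps_supported (wt_lines (rp + rm))" if "set_mset E \<subseteq> wt_lines (rp + rm)" for E
    unfolding Phi_def
    using that by (intro fps_supported_prod_mset[OF closed] fps_supported_phi[OF closed] fps_supported_cls) auto
  have Theta: "Theta E \<in> fps_supported (wt_lines (rp + rm))" if "set_mset E \<subseteq> wt_lines (rp + rm)" for E
    unfolding Theta_def
    using that
    by (intro fps_supported_prod_mset[OF closed] fps_supported_phi[OF closed] fps_supported_mult[OF closed]
        fps_supported_diff[OF closed] fps_supported_1[OF closed] fps_supported_cls) (auto intro: wt_lines_uminus)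
  have V: "set_mset (V_plus rp) \<subseteq> wt_lines (rp + rm)" "set_mset (V_minus rp rm) \<subseteq> wt_lines (rp + rm)"
    by (auto simp: V_plus_def V_minus_def coord)
  have twist: "set_mset (twist L E) \<subseteq> wt_lines (rp + rm)"
    if "L \<in> wt_lines (rp + rm)" "set_mset E \<subseteq> wt_lines (rp + rm)" for L E
    using that unfolding twist_def set_image_mset by (intro image_subsetI wt_lines_add) blast+
  have dual: "set_mset (dual_bundle E) \<subseteq> wt_lines (rp + rm)" if "set_mset E \<subseteq> wt_lines (rp + rm)" for E
    using that unfolding dual_bundle_def set_image_mset by (intro image_subsetI wt_lines_uminus) blast
  show ?thesis
    unfolding C_class_def Let_def
    using V line
    by (intro fps_supported_mult[OF closed] fps_supported_right_inverse[OF closed] fps_supported_cls Phi Theta)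
      (simp_all only: set_mset_union Un_subset_iff twist dual wt_lines_add simp_thms)
qed

lemma chi_P_supported:
  assumes "r > 0" "Poly_Mapping.keys F \<subseteq> wt_lines r"
  shows "Poly_Mapping.keys (Poly_Mapping.lookup (chi_P r F) l) \<subseteq> wts r"
proof -
  have "Poly_Mapping.lookup (chi_P r F) l = (\<Sum>(k, l', w)\<in>Poly_Mapping.keys F.
      if l' = l then Poly_Mapping.single w (Poly_Mapping.lookup F (k, l', w)) * chi_O r k else 0)"
    unfolding chi_P_def lookup_sum by (rule sum.cong) (auto simp: lookup_single when_def)
  moreover have "Poly_Mapping.keys \<dots> \<subseteq> wts r"
  proof (rule keys_sum_supported[OF wts_0 wts_add])
    fix x assume x: "x \<in> Poly_Mapping.keys F"
    obtain k l' w where [simp]: "x = (k, l', w)" by (cases x)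
    have "w \<in> wts r" using x assms(2) by (auto simp: wt_lines_def)
    then have "Poly_Mapping.keys (Poly_Mapping.single w (Poly_Mapping.lookup F x) * chi_O r k) \<subseteq> wts r"
      using keys_chi_O[OF assms(1)] by (intro keys_mult_supported[OF wts_0 wts_add]) auto
    then show "Poly_Mapping.keys (case x of (k, l', w) \<Rightarrow>
        if l' = l then Poly_Mapping.single w (Poly_Mapping.lookup F (k, l', w)) * chi_O r k else 0) \<subseteq> wts r"
      by auto
  qed
  ultimately show ?thesis by simp
qed

lemma chi_C_class_in_KA_pt_y_q:
  "rp + rm > 0 \<Longrightarrow> chi_P_fps (rp + rm) (C_class rp rm n) \<in> KA_pt_y_q (rp + rm)"
  using C_class_supported[of rp rm n] chi_P_supported[of "rp + rm"]
  unfolding KA_pt_y_q_def chi_P_fps_def fps_supported_def by simp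

section \<open>Summing the q-series of a restricted class\<close>

lemma norm_nome_less_1: "Im \<tau> > 0 \<Longrightarrow> norm (nome \<tau>) < 1"
  by (simp add: nome_def norm_exp_eq_Re)

text \<open>A zero needs q^n z = 1 with n > 0, but |q^n z| is at most |q| |z|. Applied to z =
  c_j/c_k, this turns the size condition on the parameters into nonvanishing.\<close>

lemma phi_nonzero_norm:
  fixes q :: complex
  assumes "norm q < 1" "norm q * norm z < 1"
  shows "phi q z \<noteq> 0"
proof (rule phi_nonzero[OF assms(1)])
  fix n :: nat assume "n > 0"
  then have "norm q ^ n \<le> norm q" using assms(1) power_decreasing[of 1 n "norm q"] by simp
  then have "norm (q ^ n * z) \<le> norm q * norm z"
    by (simp add: norm_mult norm_power mult_right_mono)
  then show "q ^ n * z \<noteq> 1" using assms(2) by force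
qed

lemma character_restrict_fixed:
  assumes "i < r" "\<And>j. j < r \<Longrightarrow> c j \<noteq> 0" "y \<noteq> 0"
  shows "character (restrict_fixed r c y i)"
  by unfold_locales (use assms in \<open>auto intro: restrict_fixed_add\<close>)

lemma restrict_fixed_O_line: "restrict_fixed r c y i (O_line k) = inverse (c i) powi k"
  by (simp add: restrict_fixed_def O_line_def wt_eval_def power_int_minus power_int_inverse)

lemma restrict_fixed_y_line: "restrict_fixed r c y i (y_line l) = y powi l"
  by (simp add: restrict_fixed_def y_line_def wt_eval_def)

lemma restrict_fixed_coord_line:
  assumes "j < r"
  shows "restrict_fixed r c y i (coord_line j) = c j"
proof -
  have "wt_eval r (Poly_Mapping.single j 1) c = (\<Prod>k<r. if k = j then c j else 1)"
    unfolding wt_eval_def by (rule prod.cong) (auto simp: lookup_single when_def)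
  then show ?thesis using assms by (simp add: restrict_fixed_def coord_line_def)
qed

text \<open>\<open>theta\<close> in terms of q itself: the formal series is an expansion at q = 0,
  which is not the nome of any \<tau>.\<close>

definition theta_q :: "complex \<Rightarrow> complex \<Rightarrow> complex" where
  "theta_q q u = (1 - inverse u) * phi q u * phi q (inverse u)"

text \<open>Restriction to the i-th line sends the Chern root of O(1) tensored with the j-th
  coordinate to c_j/c_i, so the restricted class is the Taylor series at q = 0 of the explicit
  function \<open>g\<close>.\<close>

lemma C_class_restrict_sums:
  fixes rp rm n c y q i
  defines "r \<equiv> rp + rm"
  assumes i: "i < r" and c: "\<And>j. j < r \<Longrightarrow> c j \<noteq> 0" and y: "y \<noteq> 0"
    and q: "norm q < 1" "\<And>j k. j < r \<Longrightarrow> k < r \<Longrightarrow> norm q * norm (c j) < norm (c k)"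
  shows "(\<lambda>d. pm_eval (restrict_fixed r c y i) (fps_nth (C_class rp rm n) d) * q ^ d) sums
    (inverse (c i) powi n * (\<Prod>j<r. theta_q q ((if j < rp then y else inverse y) * (c j / c i))) *
      inverse (\<Prod>j<r. phi q (c j / c i) * phi q (c i / c j)))"
proof -
  let ?h = "restrict_fixed r c y i"
  interpret character ?h using i c y by (intro character_restrict_fixed) auto
  define e where "e j = (if j < rp then y else inverse y)" for j
  have z: "?h (O_line 1 + coord_line j) = c j / c i" if "j < r" for j
    using that by (simp add: h_add restrict_fixed_O_line restrict_fixed_coord_line field_simps)
  have he: "?h (y_line (if j < rp then 1 else - 1)) = e j" for j
    by (simp add: restrict_fixed_y_line e_def power_int_minus)
  define F where "F = fps_const (inverse (c i) powi n) *
    (\<Prod>j<r. (1 - fps_const (inverse (e j * (c j / c i)))) * phi fps_X (fps_const (e j * (c j / c i))) *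
       phi fps_X (fps_const (inverse (e j * (c j / c i))))) *
    inverse (\<Prod>j<r. phi fps_X (fps_const (c j / c i)) * phi fps_X (fps_const (inverse (c j / c i))))"
  define g where "g X = inverse (c i) powi n * (\<Prod>j<r. theta_q X (e j * (c j / c i))) *
    inverse (\<Prod>j<r. phi X (c j / c i) * phi X (inverse (c j / c i)))" for X
  have "fps_pm_eval ?h (C_class rp rm n) = F"
    unfolding fps_pm_eval_C_class[OF character_axioms] F_def restrict_fixed_O_line he r_def[symmetric]
    by (intro arg_cong2[where f = "(*)"] arg_cong[where f = inverse] prod.cong refl) (simp_all add: z)
  then have F: "pm_eval ?h (fps_nth (C_class rp rm n) d) = fps_nth F d" for d
    by (metis fps_nth_pm_eval)
  have "fps_nth (\<Prod>j<r. phi fps_X (fps_const (c j / c i)) * phi fps_X (fps_const (inverse (c j / c i)))) 0 = 1"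
    by (induction r) simp_all
  then have g_exp: "g has_fps_expansion F"
    unfolding g_def[abs_def] F_def theta_q_def
    by (intro fps_expansion_intros phi_has_fps_expansion) simp
  \<comment> \<open>On this disc the bounds |X| < 1 and |X| |c_j| < |c_k| hold for all pairs, so no
    denominator of \<open>g\<close> vanishes; the assumptions on q say exactly that q lies in
    it.\<close>
  define R where "R = Min (insert 1 ((\<lambda>(j, k). norm (c k) / norm (c j)) ` ({..<r} \<times> {..<r})))"
  have "norm q < R"
    unfolding R_def using q c by (subst Min_gr_iff) (auto simp: field_simps)
  have R: "R \<le> 1" "R \<le> norm (c k) / norm (c j)" if "j < r" "k < r" for j k
    unfolding R_def using that by (auto intro!: Min_le)
  have nz: "phi X (c j / c k) \<noteq> 0" if "X \<in> ball 0 R" "j < r" "k < r" for X j k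
  proof (rule phi_nonzero_norm)
    show "norm X < 1" using that R(1)[of j k] by simp
    have "norm X < norm (c k) / norm (c j)" using that R(2)[of j k] by simp
    then show "norm X * norm (c j / c k) < 1"
      using that c by (simp add: norm_divide field_simps)
  qed
  have "(\<lambda>X. phi X z) holomorphic_on ball 0 R" for z
    by (rule holomorphic_on_phi) (use R(1)[OF i i] in auto)
  then have "g holomorphic_on ball 0 R"
    unfolding g_def[abs_def] theta_q_def
    by (intro holomorphic_intros) (auto simp: nz i)
  \<comment> \<open>\<open>g_exp\<close> by itself identifies series and function only near 0;
    holomorphy on the whole disc carries convergence out to q.\<close>
  then have "(\<lambda>d. fps_nth F d * q ^ d) sums g q"
    by (intro has_fps_expansion_imp_sums_complex[OF g_exp, of "ereal R"]) (use \<open>norm q < R\<close> in auto)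
  then show ?thesis
    by (simp add: F g_def e_def)
qed

section \<open>Residues\<close>

lemma theta_eq_theta_q: "theta z \<tau> = theta_q (nome \<tau>) z"
  by (simp add: theta_def theta_q_def)

lemma holomorphic_on_theta_q:
  assumes "norm q < 1" "open A" "u holomorphic_on A" "\<And>s. s \<in> A \<Longrightarrow> u s \<noteq> 0"
  shows "(\<lambda>s. theta_q q (u s)) holomorphic_on A"
  unfolding theta_q_def using assms by (intro holomorphic_intros holomorphic_on_phi) auto

text \<open>The complement of the shifted poles is cut out by the non-vanishing of the factors \<open>\<phi>\<close>, so that
  it is open although the poles accumulate at \<open>0\<close>; it is connected as its complement is countable.\<close>

lemma contour_integral_eq_residue_sum:
  fixes q :: complex and c e :: "nat \<Rightarrow> complex" and n :: int and r :: nat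
  defines "f \<equiv> \<lambda>s. s powi n * (\<Prod>j<r. theta_q q (e j * s * c j) / theta_q q (s * c j)) / s"
  assumes c: "\<And>j. j < r \<Longrightarrow> c j \<noteq> 0" "inj_on c {..<r}" and e: "\<And>j. e j \<noteq> 0"
    and q: "norm q < 1" "\<And>j k. j < r \<Longrightarrow> k < r \<Longrightarrow> norm q * norm (c j) < norm (c k)"
    and \<gamma>: "encloses_unshifted_poles r c q \<gamma>"
  shows "contour_integral \<gamma> f = 2 * of_real pi * \<i> *
    (\<Sum>i<r. inverse (c i) powi n * (\<Prod>j<r. theta_q q (e j * (c j / c i))) *
      inverse (\<Prod>j<r. phi q (c j / c i) * phi q (c i / c j)) / (\<Prod>j\<in>{..<r} - {i}. 1 - c i / c j))"
proof -
  define S where "S = {s. s \<noteq> 0 \<and> (\<forall>j<r. phi q (s * c j) \<noteq> 0 \<and> phi q (inverse (s * c j)) \<noteq> 0)}"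
  define pts where "pts = (\<lambda>i. inverse (c i)) ` {..<r}"
  define P where "P s = (\<Prod>j<r. phi q (s * c j) * phi q (inverse (s * c j)))" for s
  have hol_phi: "(\<lambda>s. phi q (s * c j)) holomorphic_on - {0}"
    "(\<lambda>s. phi q (inverse (s * c j))) holomorphic_on - {0}" if "j < r" for j
    using q(1) c(1)[OF that] by (auto intro!: holomorphic_on_phi holomorphic_intros)
  have "P holomorphic_on - {0}"
    unfolding P_def[abs_def] using hol_phi by (intro holomorphic_intros) auto
  then have "open (- {0} \<inter> P -` (- {0}))"
    by (intro continuous_open_preimage holomorphic_on_imp_continuous_on) auto
  moreover have "S = - {0} \<inter> P -` (- {0})"
    by (auto simp: S_def P_def)
  ultimately have "open S" by simp
  \<comment> \<open>Zeros of phi(s c_j) give positive shifts m, zeros of phi(1/(s c_j)) negative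
    ones. Hence the points left out of S are 0 and shifted poles with m nonzero, all of winding
    number 0, as the residue theorem requires.\<close>
  have pole: "\<exists>m\<noteq>0. \<exists>i<r. s = shifted_pole q c m i" if "s \<notin> S" "s \<noteq> 0" for s
  proof -
    from that obtain j where j: "j < r" "phi q (s * c j) = 0 \<or> phi q (inverse (s * c j)) = 0"
      by (auto simp: S_def)
    then consider k where "k > 0" "q ^ k * (s * c j) = 1" | k where "k > 0" "q ^ k * inverse (s * c j) = 1"
      using phi_nonzero[OF q(1)] by metis
    then show ?thesis
    proof cases
      case 1
      then have "inverse (q ^ k * c j) = s" by (intro inverse_unique) (simp add: ac_simps)
      then have "s = shifted_pole q c (int k) j" by (simp add: shifted_pole_def)
      with 1 j show ?thesis by (intro exI[of _ "int k"]) auto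
    next
      case 2
      then have "q ^ k = s * c j" using that c(1)[OF j(1)] by (simp add: field_simps)
      then have "s = shifted_pole q c (- int k) j"
        using c(1)[OF j(1)] by (simp add: shifted_pole_def power_int_minus field_simps)
      with 2 j show ?thesis by (intro exI[of _ "- int k"]) auto
    qed
  qed
  have "- S \<subseteq> insert 0 (\<Union>i\<in>{..<r}. range (\<lambda>m. shifted_pole q c m i))"
    using pole by blast
  then have "countable (- S)" by (rule countable_subset) auto
  then have "path_connected (- (- S))" by (intro path_connected_complement_countable) auto
  then have "connected S" by (simp add: path_connected_imp_connected)
  have pole0: "inverse (c i) = shifted_pole q c 0 i" for i
    by (simp add: shifted_pole_def)
  have off_path: "shifted_pole q c m i \<notin> path_image \<gamma>"
    and winding_pole: "winding_number \<gamma> (shifted_pole q c m i) = (if m = 0 then 1 else 0)"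
    if "i < r" for m i
    using \<gamma> that unfolding encloses_unshifted_poles_def by blast+
  have path: "valid_path \<gamma>" "pathfinish \<gamma> = pathstart \<gamma>" "0 \<notin> path_image \<gamma>" "winding_number \<gamma> 0 = 0"
    using \<gamma> unfolding encloses_unshifted_poles_def by blast+
  have image: "path_image \<gamma> \<subseteq> S - pts"
    using pole off_path path(3) unfolding pts_def pole0 by blast
  have winding: "winding_number \<gamma> s = 0" if "s \<notin> S" for s
  proof (cases "s = 0")
    case False
    with pole[OF that] winding_pole show ?thesis by auto
  qed (simp add: path)
  have theta_nz: "theta_q q (s * c j) \<noteq> 0" if "s \<in> S" "j < r" "s \<noteq> inverse (c j)" for s j
  proof -
    have "s * c j \<noteq> 1" using that c(1)[OF that(2)] by (auto simp: field_simps)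
    then have "inverse (s * c j) \<noteq> 1" by (simp only: inverse_eq_1_iff not_False_eq_True)
    then show ?thesis using that by (auto simp: theta_q_def S_def simp del: inverse_mult_distrib)
  qed
  have hol_num: "(\<lambda>s. theta_q q (e j * s * c j)) holomorphic_on A" if "open A" "0 \<notin> A" "j < r" for A j
    using that c(1)[OF that(3)] e by (intro holomorphic_on_theta_q[OF q(1)] holomorphic_intros) auto
  have "open (S - pts)" using \<open>open S\<close> by (intro open_Diff finite_imp_closed) (auto simp: pts_def)
  have hol: "f holomorphic_on S - pts"
    unfolding f_def
  proof (intro holomorphic_intros hol_num holomorphic_on_theta_q[OF q(1)] \<open>open (S - pts)\<close>)
    fix s j assume "s \<in> S - pts" "j \<in> {..<r}"
    then show "theta_q q (s * c j) \<noteq> 0" by (intro theta_nz) (auto simp: pts_def)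
  qed (use c in \<open>auto simp: S_def\<close>)
  have residue: "residue f (inverse (c i)) = inverse (c i) powi n * (\<Prod>j<r. theta_q q (e j * (c j / c i))) *
      inverse (\<Prod>j<r. phi q (c j / c i) * phi q (c i / c j)) / (\<Prod>j\<in>{..<r} - {i}. 1 - c i / c j)"
    if i: "i < r" for i
  proof -
    define A where "A = S - (\<lambda>i. inverse (c i)) ` ({..<r} - {i})"
    \<comment> \<open>\<open>H\<close> is the integrand with the factor 1 - 1/(s c_i) and the 1/s
      taken out. Their denominators combine to (1 - 1/(s c_i)) s = s - 1/c_i, so the residue is the
      value of \<open>H\<close> with no extra factor.\<close>
    define H where "H s = s powi n * (\<Prod>j<r. theta_q q (e j * s * c j)) * inverse (P s) /
      (\<Prod>j\<in>{..<r} - {i}. 1 - inverse (s * c j))" for s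
    have "open A" unfolding A_def using \<open>open S\<close> by (intro open_Diff finite_imp_closed) auto
    have A_nz: "s \<noteq> 0" "P s \<noteq> 0" if "s \<in> A" for s
      using that by (auto simp: A_def S_def P_def)
    have A_nz': "1 - inverse (s * c j) \<noteq> 0" if "s \<in> A" "j < r" "j \<noteq> i" for s j
    proof
      assume "1 - inverse (s * c j) = 0"
      then have "s * c j = 1" using A_nz[OF that(1)] c(1)[OF that(2)] by (simp add: field_simps)
      then have "s = inverse (c j)" using c(1)[OF that(2)] by (simp add: field_simps)
      then show False using that by (auto simp: A_def)
    qed
    \<comment> \<open>The size condition on the parameters prevents an unshifted pole from
      coinciding with a shifted one, so the pole at 1/c_i is simple.\<close>
    have "inverse (c i) \<in> S"
    proof -
      have "phi q (c j / c k) \<noteq> 0" if "j < r" "k < r" for j k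
        using q(2)[OF that] c(1)[OF that(2)]
        by (intro phi_nonzero_norm[OF q(1)]) (simp add: norm_divide field_simps)
      then have "phi q (inverse (c i) * c j) \<noteq> 0" "phi q (inverse (inverse (c i) * c j)) \<noteq> 0" if "j < r" for j
        using i that by (simp_all add: divide_inverse mult.commute)
      then show ?thesis using nonzero_imp_inverse_nonzero[OF c(1)[OF i]] unfolding S_def by blast
    qed
    moreover have "inverse (c i) \<noteq> inverse (c j)" if "j < r" "j \<noteq> i" for j
      using that i c(2) by (auto simp: inj_on_def)
    ultimately have iA: "inverse (c i) \<in> A" unfolding A_def by blast
    have "P holomorphic_on A"
      using \<open>P holomorphic_on - {0}\<close> A_nz(1) by (auto intro: holomorphic_on_subset)
    moreover have "0 \<notin> A" using A_nz by blast
    ultimately have "H holomorphic_on A"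
      unfolding H_def[abs_def] using A_nz A_nz' \<open>open A\<close> c by (intro holomorphic_intros hol_num) auto
    have split: "(\<Prod>j<r. 1 - inverse (s * c j)) = (1 - inverse (s * c i)) * (\<Prod>j\<in>{..<r} - {i}. 1 - inverse (s * c j))" for s
      using i by (intro prod.remove) auto
    have f_eq: "f s = H s / (s - inverse (c i))" if s: "s \<noteq> 0" for s
    proof -
      have "(\<Prod>j<r. theta_q q (s * c j)) = (\<Prod>j<r. 1 - inverse (s * c j)) * P s"
        unfolding theta_q_def P_def prod.distrib[symmetric] by (simp add: mult.assoc)
      then have "f s = s powi n * ((\<Prod>j<r. theta_q q (e j * s * c j)) /
          ((1 - inverse (s * c i)) * (\<Prod>j\<in>{..<r} - {i}. 1 - inverse (s * c j)) * P s)) / s"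
        by (simp only: f_def prod_dividef split)
      also have "\<dots> = H s / ((1 - inverse (s * c i)) * s)"
      proof -
        have "x * (N / (u * w * p)) / s = x * N * inverse p / w / (u * s)" for x N u w p
          by (simp add: divide_inverse ac_simps)
        then show ?thesis unfolding H_def .
      qed
      also have "(1 - inverse (s * c i)) * s = s - inverse (c i)"
        using s by (simp add: left_diff_distrib)
      finally show ?thesis .
    qed
    have "residue f (inverse (c i)) = residue (\<lambda>s. H s / (s - inverse (c i))) (inverse (c i))"
    proof (rule residue_cong)
      show "\<forall>\<^sub>F s in at (inverse (c i)). f s = H s / (s - inverse (c i))"
        using eventually_at_in_open'[OF \<open>open A\<close> iA] by eventually_elim (simp add: f_eq A_nz)
    qed simp
    also have "\<dots> = H (inverse (c i))"
      by (rule residue_simple[OF \<open>open A\<close> iA \<open>H holomorphic_on A\<close>])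
    also have "\<dots> = inverse (c i) powi n * (\<Prod>j<r. theta_q q (e j * (c j / c i))) *
      inverse (\<Prod>j<r. phi q (c j / c i) * phi q (c i / c j)) / (\<Prod>j\<in>{..<r} - {i}. 1 - c i / c j)"
      by (simp add: H_def P_def field_simps)
    finally show ?thesis .
  qed
  have "contour_integral \<gamma> f = 2 * pi * \<i> * (\<Sum>p\<in>pts. winding_number \<gamma> p * residue f p)"
    using \<open>open S\<close> \<open>connected S\<close> hol image winding path
    by (intro Residue_theorem) (auto simp: pts_def)
  also have "(\<Sum>p\<in>pts. winding_number \<gamma> p * residue f p) = (\<Sum>i<r. residue f (inverse (c i)))"
  proof -
    have "winding_number \<gamma> (inverse (c i)) = 1" if "i < r" for i
      unfolding pole0 using winding_pole[OF that] by simp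
    then show ?thesis
      unfolding pts_def using c(2) by (subst sum.reindex) (auto simp: inj_on_def)
  qed
  finally show ?thesis using residue by simp
qed

lemma prod_lessThan_add:
  fixes g :: "nat \<Rightarrow> 'a::comm_monoid_mult"
  shows "(\<Prod>j<m + n. g j) = (\<Prod>j<m. g j) * (\<Prod>j<n. g (m + j))"
  by (induction n) (simp_all add: mult.assoc)

theorem proposition3p2:
  fixes rp rm :: nat and n :: int
  assumes "rp + rm > 0"
  defines "X \<equiv> chi_P_fps (rp + rm) (C_class rp rm n)"
  shows "X \<in> KA_pt_y_q (rp + rm) \<and>
    (\<forall>(a :: nat \<Rightarrow> complex) (b :: nat \<Rightarrow> complex) (\<tau> :: complex) (y :: complex) (\<gamma> :: real \<Rightarrow> complex).
       let c = equiv_params rp a b; q = nome \<tau> in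
       (\<forall>i<rp. norm (a i) > 1) \<longrightarrow> (\<forall>j<rm. norm (b j) > 1) \<longrightarrow>
       inj_on c {..<rp + rm} \<longrightarrow>
       y \<noteq> 0 \<longrightarrow> Im \<tau> > 0 \<longrightarrow>
       (\<forall>i<rp + rm. \<forall>j<rp + rm. norm q * norm (c i) < norm (c j)) \<longrightarrow>
       encloses_unshifted_poles (rp + rm) c q \<gamma> \<longrightarrow>
       (\<lambda>d. KAy_eval (rp + rm) c y (fps_nth X d) * q ^ d) sums C_integral rp rm n \<gamma> a b \<tau> y)"
  unfolding Let_def
proof (intro conjI allI impI)
  show "X \<in> KA_pt_y_q (rp + rm)"
    unfolding X_def using assms(1) by (rule chi_C_class_in_KA_pt_y_q)
next
  fix a b :: "nat \<Rightarrow> complex" and \<tau> y :: complex and \<gamma> :: "real \<Rightarrow> complex"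
  define c where "c = equiv_params rp a b"
  define q where "q = nome \<tau>"
  define r where "r = rp + rm"
  define e where "e j = (if j < rp then y else inverse y)" for j
  assume ab: "\<forall>i<rp. norm (a i) > 1" "\<forall>j<rm. norm (b j) > 1"
    and inj: "inj_on (equiv_params rp a b) {..<rp + rm}" and y: "y \<noteq> 0" and \<tau>: "Im \<tau> > 0"
    and gap: "\<forall>i<rp + rm. \<forall>j<rp + rm. norm (nome \<tau>) * norm (equiv_params rp a b i) < norm (equiv_params rp a b j)"
    and \<gamma>: "encloses_unshifted_poles (rp + rm) (equiv_params rp a b) (nome \<tau>) \<gamma>"
  note defs = c_def[symmetric] q_def[symmetric] r_def[symmetric]
  have r: "r > 0" using assms(1) by (simp add: r_def)
  have c: "c j \<noteq> 0" if "j < r" for j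
  proof -
    have "norm (c j) > 1" using ab that by (auto simp: c_def equiv_params_def r_def)
    then show ?thesis by auto
  qed
  have inj: "inj_on c {..<r}" using inj unfolding defs .
  have q: "norm q < 1" using \<tau> by (simp add: q_def norm_nome_less_1)
  have gap: "norm q * norm (c j) < norm (c k)" if "j < r" "k < r" for j k
    using gap that unfolding defs by blast
  define D where "D i = (\<Prod>j\<in>{..<r} - {i}. 1 - c i / c j)" for i
  define G where "G i = inverse (c i) powi n * (\<Prod>j<r. theta_q q (e j * (c j / c i))) *
      inverse (\<Prod>j<r. phi q (c j / c i) * phi q (c i / c j))" for i
  have "(\<lambda>d. pm_eval (restrict_fixed r c y i) (fps_nth (C_class rp rm n) d) * q ^ d) sums G i" if "i < r" for i
    unfolding G_def e_def r_def
    by (rule C_class_restrict_sums) (use that c y q gap in \<open>auto simp: r_def\<close>)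
  \<comment> \<open>The localization denominators do not depend on d, so the finitely many
    convergent series, one for each coordinate line, may be divided and added.\<close>
  then have "(\<lambda>d. \<Sum>i<r. pm_eval (restrict_fixed r c y i) (fps_nth (C_class rp rm n) d) * q ^ d / D i) sums
      (\<Sum>i<r. G i / D i)"
    by (intro sums_sum sums_divide) auto
  moreover have "(\<Sum>i<r. pm_eval (restrict_fixed r c y i) (fps_nth (C_class rp rm n) d) * q ^ d / D i) =
      KAy_eval r c y (fps_nth X d) * q ^ d" for d
    unfolding X_def chi_P_fps_def r_def[symmetric]
    using localization[OF r c inj] by (simp add: D_def sum_distrib_right)
  moreover have "C_integral rp rm n \<gamma> a b \<tau> y = (\<Sum>i<r. G i / D i)"
  proof -
    \<comment> \<open>The two products over the a_i and the b_j become one product over all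
      coordinates, with \<open>e\<close> recording whether the shift is by y or by its
      inverse.\<close>
    have "C_integrand rp rm n a b \<tau> y =
        (\<lambda>s. s powi n * (\<Prod>j<r. theta_q q (e j * s * c j) / theta_q q (s * c j)) / s)"
      by (rule ext) (simp add: C_integrand_def r_def prod_lessThan_add theta_eq_theta_q q_def e_def c_def
          equiv_params_def mult.assoc)
    moreover have "e j \<noteq> 0" for j using y by (simp add: e_def)
    ultimately show ?thesis
      unfolding C_integral_def G_def D_def
      using contour_integral_eq_residue_sum[OF c inj _ q gap \<gamma>[unfolded defs], of e n] by simp
  qed
  ultimately show "(\<lambda>d. KAy_eval (rp + rm) (equiv_params rp a b) y (fps_nth X d) * nome \<tau> ^ d) sums
      C_integral rp rm n \<gamma> a b \<tau> y"
    unfolding defs by simp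
qed

end
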